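(* If there is only one customer type ($T=1$) and given any $\epsilon>0$, the maximum capture problem (MCP) under the nested logit (NL) model, namely maximizing $$F(x)=q_1\,\frac{\sum_{n\in[N]}W_n(x)^{\sigma_n-1}\left(\sum_{i\in\mathcal{N}_n\cap[m]}V_i x_i\right)}{\sum_{n\in[N]}W_n(x)^{\sigma_n}}$$ over $x\in\mathcal{X}=\{x\in\{0,1\}^m:\ \sum_{i\in[m]}x_i\le r\}$, where $W_n(x)=\sum_{i\in\mathcal{N}_n\cap[m]}V_i x_i+\sum_{i\in\mathcal{N}_n\cap\mathcal{C}}V_i$, can be solved to an $\epsilon$-optimal solution in $\mathcal{O}(m^2r^2\log(1/\epsilon))$. In other words, a solution $\widehat{x}$ such that $F(\widehat{x})\ge\max_{x\in\mathcal{X}}F(x)-\epsilon$ can be found in $\mathcal{O}(m^2r^2\log(1/\epsilon))$.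
   Context: Notation: $[k]=\{1,\dots,k\}$. $[m]$ is the set of candidate locations, $\mathcal{C}$ is the set of the competitor's existing facilities, and $r$ is the maximum number of facilities to open; $x_i=1$ if and only if location $i$ is chosen. In the NL model every facility or location in $[m]\cup\mathcal{C}$ belongs to exactly one of the nests $\mathcal{N}_1,\dots,\mathcal{N}_N$; competitor and new facilities may share nests. Each nest $\mathcal{N}_n$ has a dissimilarity parameter $\sigma_n\in(0,1]$. For $i\in\mathcal{N}_n$, $V_i=e^{v_i/\sigma_n}$, where $v_i$ is the given deterministic utility of $i$ for the single customer type. $q_1$ is the total demand of the single customer type.
   Formalization: The running time is proved as O(m²r²·log(max(2,1/ε)) + |C|) for m,r ≥ 1, in exact real arithmetic with unit-cost exp and log: the linear term for reading the competitor's facilities is added, and log(1/ε) is replaced by log 2 when ε > 1/2, where it could be zero or negative. *)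

theory Defs
  imports "HOL-Analysis.Analysis"
begin

section \<open>The maximum capture problem under the nested logit model\<close>

record mcp_nl =
  num_locs :: nat                  \<comment> \<open>\<open>m\<close>; the candidate locations are \<open>{1..m}\<close>\<close>
  capacity :: nat                  \<comment> \<open>\<open>r\<close>\<close>
  competitors :: "nat set"         \<comment> \<open>\<open>\<C>\<close>\<close>
  num_nests :: nat                 \<comment> \<open>\<open>N\<close>\<close>
  nest :: "nat \<Rightarrow> nat set"         \<comment> \<open>\<open>\<N>\<^sub>n\<close>\<close>
  dissim :: "nat \<Rightarrow> real"          \<comment> \<open>\<open>\<sigma>\<^sub>n\<close>\<close>
  utility :: "nat \<Rightarrow> real"         \<comment> \<open>\<open>v\<^sub>i\<close>\<close>
  demand :: real                   \<comment> \<open>\<open>q\<^sub>1\<close>\<close>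

definition locs :: "mcp_nl \<Rightarrow> nat set" where
  "locs I = {1..num_locs I}"

definition mcp_nl_instance :: "mcp_nl \<Rightarrow> bool" where
  "mcp_nl_instance I \<longleftrightarrow>
     finite (competitors I) \<and>
     locs I \<inter> competitors I = {} \<and>
     (\<forall>i \<in> locs I \<union> competitors I. \<exists>!n. n \<in> {1..num_nests I} \<and> i \<in> nest I n) \<and>
     (\<forall>n \<in> {1..num_nests I}. 0 < dissim I n \<and> dissim I n \<le> 1) \<and>
     0 \<le> demand I"

definition nest_of :: "mcp_nl \<Rightarrow> nat \<Rightarrow> nat" where
  "nest_of I i = (THE n. n \<in> {1..num_nests I} \<and> i \<in> nest I n)"

definition V :: "mcp_nl \<Rightarrow> nat \<Rightarrow> real" where
  "V I i = exp (utility I i / dissim I (nest_of I i))"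

definition feasible :: "mcp_nl \<Rightarrow> (nat \<Rightarrow> nat) set" where
  "feasible I = {x \<in> locs I \<rightarrow>\<^sub>E {0, 1}. (\<Sum>i \<in> locs I. x i) \<le> capacity I}"

definition W :: "mcp_nl \<Rightarrow> (nat \<Rightarrow> nat) \<Rightarrow> nat \<Rightarrow> real" where
  "W I x n = (\<Sum>i \<in> nest I n \<inter> locs I. V I i * real (x i))
           + (\<Sum>i \<in> nest I n \<inter> competitors I. V I i)"

text \<open>
  If \<open>W I x n = 0\<close>, no facility of nest \<open>n\<close> is open; by \<open>0 powr a = 0\<close> both of its summands
  vanish. If no facility is open at all, the captured demand is \<open>0 / 0 = 0\<close>.
\<close>

definition F :: "mcp_nl \<Rightarrow> (nat \<Rightarrow> nat) \<Rightarrow> real" where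
  "F I x = demand I *
     ((\<Sum>n = 1..num_nests I.
         W I x n powr (dissim I n - 1) * (\<Sum>i \<in> nest I n \<inter> locs I. V I i * real (x i)))
      / (\<Sum>n = 1..num_nests I. W I x n powr dissim I n))"


section \<open>A real RAM\<close>

text \<open>
  Running time is measured on structured programs over two zero-initialised, randomly accessible
  memories: one of natural numbers, the only one usable for addressing, and one of exact reals.
  Each memory consists of named unbounded arrays. Every operation, constant and memory access
  costs one step. To keep unit costs honest, natural numbers have no multiplication, there is
  no rounding or other transfer from reals to naturals except through the order test, and the
  only real literals are naturals. The exponential and the logarithm are elementary operations,
  since \<open>V\<^sub>i\<close> and the powers of \<open>W\<^sub>n\<close> are transcendental in the data.
\<close>

datatype nexp =
    NConst nat
  | NGet string nexp
  | NPlus nexp nexp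
  | NMinus nexp nexp

datatype rexp =
    RConst nat
  | RGet string nexp
  | RPlus rexp rexp
  | RMinus rexp rexp
  | RTimes rexp rexp
  | RDivide rexp rexp
  | RExp rexp
  | RLn rexp

datatype bexp =
    NLess nexp nexp
  | RLess rexp rexp
  | BNot bexp
  | BAnd bexp bexp

datatype com =
    Skip
  | NPut string nexp nexp
  | RPut string nexp rexp
  | Seq com com
  | Cond bexp com com
  | Loop bexp com

type_synonym state = "(string \<Rightarrow> nat \<Rightarrow> nat) \<times> (string \<Rightarrow> nat \<Rightarrow> real)"

primrec nval :: "nexp \<Rightarrow> state \<Rightarrow> nat" where
  "nval (NConst k) s = k"
| "nval (NGet a e) s = fst s a (nval e s)"
| "nval (NPlus e f) s = nval e s + nval f s"
| "nval (NMinus e f) s = nval e s - nval f s"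

primrec rval :: "rexp \<Rightarrow> state \<Rightarrow> real" where
  "rval (RConst k) s = real k"
| "rval (RGet a e) s = snd s a (nval e s)"
| "rval (RPlus e f) s = rval e s + rval f s"
| "rval (RMinus e f) s = rval e s - rval f s"
| "rval (RTimes e f) s = rval e s * rval f s"
| "rval (RDivide e f) s = rval e s / rval f s"
| "rval (RExp e) s = exp (rval e s)"
| "rval (RLn e) s = ln (rval e s)"

primrec bval :: "bexp \<Rightarrow> state \<Rightarrow> bool" where
  "bval (NLess e f) s = (nval e s < nval f s)"
| "bval (RLess e f) s = (rval e s < rval f s)"
| "bval (BNot b) s = (\<not> bval b s)"
| "bval (BAnd b c) s = (bval b s \<and> bval c s)"

primrec ncost :: "nexp \<Rightarrow> nat" where
  "ncost (NConst k) = 1"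
| "ncost (NGet a e) = 1 + ncost e"
| "ncost (NPlus e f) = 1 + ncost e + ncost f"
| "ncost (NMinus e f) = 1 + ncost e + ncost f"

primrec rcost :: "rexp \<Rightarrow> nat" where
  "rcost (RConst k) = 1"
| "rcost (RGet a e) = 1 + ncost e"
| "rcost (RPlus e f) = 1 + rcost e + rcost f"
| "rcost (RMinus e f) = 1 + rcost e + rcost f"
| "rcost (RTimes e f) = 1 + rcost e + rcost f"
| "rcost (RDivide e f) = 1 + rcost e + rcost f"
| "rcost (RExp e) = 1 + rcost e"
| "rcost (RLn e) = 1 + rcost e"

primrec bcost :: "bexp \<Rightarrow> nat" where
  "bcost (NLess e f) = 1 + ncost e + ncost f"
| "bcost (RLess e f) = 1 + rcost e + rcost f"
| "bcost (BNot b) = 1 + bcost b"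
| "bcost (BAnd b c) = 1 + bcost b + bcost c"

definition nput :: "string \<Rightarrow> nat \<Rightarrow> nat \<Rightarrow> state \<Rightarrow> state" where
  "nput a j k s = ((fst s)(a := (fst s a)(j := k)), snd s)"

definition rput :: "string \<Rightarrow> nat \<Rightarrow> real \<Rightarrow> state \<Rightarrow> state" where
  "rput a j z s = (fst s, (snd s)(a := (snd s a)(j := z)))"

text \<open>\<open>runs c s t s'\<close>: started in \<open>s\<close>, the program \<open>c\<close> halts in \<open>s'\<close> after exactly \<open>t\<close> steps.\<close>

inductive runs :: "com \<Rightarrow> state \<Rightarrow> nat \<Rightarrow> state \<Rightarrow> bool" where
  Skip: "runs Skip s 1 s"
| NPut: "runs (NPut a e f) s (1 + ncost e + ncost f) (nput a (nval e s) (nval f s) s)"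
| RPut: "runs (RPut a e f) s (1 + ncost e + rcost f) (rput a (nval e s) (rval f s) s)"
| Seq: "runs c s t s' \<Longrightarrow> runs d s' u s'' \<Longrightarrow> runs (Seq c d) s (t + u) s''"
| CondTrue: "bval b s \<Longrightarrow> runs c s t s' \<Longrightarrow> runs (Cond b c d) s (bcost b + t) s'"
| CondFalse: "\<not> bval b s \<Longrightarrow> runs d s t s' \<Longrightarrow> runs (Cond b c d) s (bcost b + t) s'"
| LoopFalse: "\<not> bval b s \<Longrightarrow> runs (Loop b c) s (bcost b) s"
| LoopTrue: "bval b s \<Longrightarrow> runs c s t s' \<Longrightarrow> runs (Loop b c) s' u s'' \<Longrightarrow>
    runs (Loop b c) s (bcost b + t + u) s''"


section \<open>Input and output\<close>

text \<open>
  Scalars are stored at index 0. The competitor's facilities are listed in the array \<open>C\<close>. Nest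
  labels and utilities are indexed by the facility, dissimilarity parameters by the nest.
\<close>

definition scalar :: "'a::zero \<Rightarrow> nat \<Rightarrow> 'a" where
  "scalar z = (\<lambda>_. 0)(0 := z)"

definition input :: "mcp_nl \<Rightarrow> real \<Rightarrow> state" where
  "input I \<epsilon> =
    ((\<lambda>_ _. 0)
       (''m'' := scalar (num_locs I),
        ''r'' := scalar (capacity I),
        ''N'' := scalar (num_nests I),
        ''k'' := scalar (card (competitors I)),
        ''C'' := (\<lambda>j. if j < card (competitors I)
                      then sorted_list_of_set (competitors I) ! j else 0),
        ''nest'' := (\<lambda>i. if i \<in> locs I \<union> competitors I then nest_of I i else 0)),
     (\<lambda>_ _. 0)
       (''eps'' := scalar \<epsilon>,
        ''q'' := scalar (demand I),
        ''sigma'' := (\<lambda>n. if n \<in> {1..num_nests I} then dissim I n else 0),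
        ''v'' := (\<lambda>i. if i \<in> locs I \<union> competitors I then utility I i else 0)))"

definition solution :: "mcp_nl \<Rightarrow> state \<Rightarrow> (nat \<Rightarrow> nat)" where
  "solution I s = restrict (fst s ''x'') (locs I)"

text \<open>
  The hidden constant of the time bound is to be absolute: it depends neither on \<open>m\<close>, \<open>r\<close>,
  \<open>\<epsilon>\<close> nor on any other datum of the instance. The summand \<open>card (competitors I)\<close> pays for
  reading the competitor's data, which every algorithm has to do; for a fixed competitor it is
  absorbed. Since \<open>m\<^sup>2 r\<^sup>2 ln (1/\<epsilon>)\<close> is not positive for \<open>\<epsilon> \<ge> 1\<close>, \<open>1/\<epsilon>\<close> is replaced by 2 when
  \<open>\<epsilon> > 1/2\<close>.
\<close>

definition time_bound :: "mcp_nl \<Rightarrow> real \<Rightarrow> real" where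
  "time_bound I \<epsilon> =
     (real (num_locs I))\<^sup>2 * (real (capacity I))\<^sup>2 * ln (max 2 (1 / \<epsilon>))
     + real (card (competitors I))"

end

theory Submission
  imports Defs
begin

text \<open>
  The problem is solved exactly. For a multiplier \<open>\<mu> \<le> 1\<close>, the contribution of a nest to numerator
  minus \<open>\<mu>\<close> times denominator is an increasing and concave function of its weight \<open>W\<^sub>n\<close>. List the
  locations of each nest by decreasing \<open>V\<close>, and give each location its marginal numerator \<open>a\<^sub>i\<close> and
  marginal denominator \<open>b\<^sub>i\<close> when the locations of its nest are opened in this order. By concavity,
  \<open>\<Sum>(a\<^sub>i - \<mu> b\<^sub>i)\<close> underestimates the value of every set, with equality for sets that respect the
  order, and these are the best ones of their size. So it suffices to maximise
  \<open>\<Sum>a\<^sub>i / (B + \<Sum>b\<^sub>i)\<close> over all sets of \<open>min m r\<close> locations, whether or not they respect the order.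

  This is done by Megiddo's parametric search. An optimal set consists of the \<open>min m r\<close> largest
  values \<open>a\<^sub>i - \<rho> b\<^sub>i\<close>, where \<open>\<rho>\<close> is the unknown optimal ratio. They are selected by \<open>O(m r)\<close>
  comparisons, and each comparison amounts to the position of \<open>\<rho>\<close> relative to a known number \<open>\<mu>\<close>,
  which is the sign of the maximum of \<open>\<Sum>(a\<^sub>i - \<mu> b\<^sub>i) - \<mu> B\<close>, found greedily in \<open>O(m r)\<close> steps.
\<close>

section \<open>Running times of programs\<close>

definition halts :: "com \<Rightarrow> nat \<Rightarrow> state \<Rightarrow> (state \<Rightarrow> bool) \<Rightarrow> bool" where
  "halts c T s Q \<longleftrightarrow> (\<exists>t s'. runs c s t s' \<and> t \<le> T \<and> Q s')"

primrec nwrites :: "com \<Rightarrow> string set" where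
  "nwrites Skip = {}"
| "nwrites (NPut a e f) = {a}"
| "nwrites (RPut a e f) = {}"
| "nwrites (Seq c d) = nwrites c \<union> nwrites d"
| "nwrites (Cond b c d) = nwrites c \<union> nwrites d"
| "nwrites (Loop b c) = nwrites c"

primrec rwrites :: "com \<Rightarrow> string set" where
  "rwrites Skip = {}"
| "rwrites (NPut a e f) = {}"
| "rwrites (RPut a e f) = {a}"
| "rwrites (Seq c d) = rwrites c \<union> rwrites d"
| "rwrites (Cond b c d) = rwrites c \<union> rwrites d"
| "rwrites (Loop b c) = rwrites c"

definition framed :: "com \<Rightarrow> state \<Rightarrow> state \<Rightarrow> bool" where
  "framed c s s' \<longleftrightarrow>
     (\<forall>a. a \<notin> nwrites c \<longrightarrow> fst s' a = fst s a) \<and> (\<forall>a. a \<notin> rwrites c \<longrightarrow> snd s' a = snd s a)"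

lemma fst_nput [simp]: "fst (nput a j k s) b = (if b = a then (fst s a)(j := k) else fst s b)"
  and snd_nput [simp]: "snd (nput a j k s) = snd s"
  and fst_rput [simp]: "fst (rput a j z s) = fst s"
  and snd_rput [simp]: "snd (rput a j z s) b = (if b = a then (snd s a)(j := z) else snd s b)"
  by (auto simp: nput_def rput_def)

lemma runs_framed: "runs c s t s' \<Longrightarrow> framed c s s'"
  by (induction rule: runs.induct) (auto simp: framed_def)

lemma halts_framed:
  "halts c T s Q \<Longrightarrow> halts c T s (\<lambda>s'. Q s' \<and> framed c s s')"
  unfolding halts_def using runs_framed by blast

lemma halts_mono:
  "halts c T s Q \<Longrightarrow> T \<le> T' \<Longrightarrow> (\<And>s'. Q s' \<Longrightarrow> framed c s s' \<Longrightarrow> Q' s') \<Longrightarrow> halts c T' s Q'"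
  unfolding halts_def using runs_framed order_trans by blast

lemma halts_Seq:
  assumes "halts c T s R" "\<And>s'. R s' \<Longrightarrow> framed c s s' \<Longrightarrow> halts d U s' Q"
  shows "halts (Seq c d) (T + U) s Q"
proof -
  obtain t s' where t: "runs c s t s'" "t \<le> T" "R s'" using assms(1) by (auto simp: halts_def)
  obtain u s'' where u: "runs d s' u s''" "u \<le> U" "Q s''"
    using assms(2)[OF t(3) runs_framed[OF t(1)]] by (auto simp: halts_def)
  show ?thesis unfolding halts_def using runs.Seq[OF t(1) u(1)] t(2) u(2,3) by (meson add_mono)
qed

lemma halts_Cond:
  assumes "bval b s \<Longrightarrow> halts c T s Q" "\<not> bval b s \<Longrightarrow> halts d U s Q"
    and "bcost b + max T U \<le> T'"
  shows "halts (Cond b c d) T' s Q"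
proof (cases "bval b s")
  case True
  then obtain t s' where "runs c s t s'" "t \<le> T" "Q s'" using assms(1) by (auto simp: halts_def)
  with runs.CondTrue[OF True, of c t s' d] show ?thesis
    unfolding halts_def using assms(3) by (intro exI[of _ "bcost b + t"] exI[of _ s']) auto
next
  case False
  then obtain t s' where "runs d s t s'" "t \<le> U" "Q s'" using assms(2) by (auto simp: halts_def)
  with runs.CondFalse[OF False, of d t s' c] show ?thesis
    unfolding halts_def using assms(3) by (intro exI[of _ "bcost b + t"] exI[of _ s']) auto
qed

primrec loop_free :: "com \<Rightarrow> bool" where
  "loop_free Skip = True"
| "loop_free (NPut a e f) = True"
| "loop_free (RPut a e f) = True"
| "loop_free (Seq c d) = (loop_free c \<and> loop_free d)"
| "loop_free (Cond b c d) = (loop_free c \<and> loop_free d)"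
| "loop_free (Loop b c) = False"

primrec exec :: "com \<Rightarrow> state \<Rightarrow> state" where
  "exec Skip s = s"
| "exec (NPut a e f) s = nput a (nval e s) (nval f s) s"
| "exec (RPut a e f) s = rput a (nval e s) (rval f s) s"
| "exec (Seq c d) s = exec d (exec c s)"
| "exec (Cond b c d) s = (if bval b s then exec c s else exec d s)"
| "exec (Loop b c) s = s"

primrec worst :: "com \<Rightarrow> nat" where
  "worst Skip = 1"
| "worst (NPut a e f) = 1 + ncost e + ncost f"
| "worst (RPut a e f) = 1 + ncost e + rcost f"
| "worst (Seq c d) = worst c + worst d"
| "worst (Cond b c d) = bcost b + max (worst c) (worst d)"
| "worst (Loop b c) = 0"

lemma halts_worst:
  "loop_free c \<Longrightarrow> Q (exec c s) \<Longrightarrow> halts c (worst c) s Q"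
proof (induction c arbitrary: s Q)
  case Skip
  then show ?case unfolding halts_def using runs.Skip by fastforce
next
  case (NPut a e f)
  then show ?case unfolding halts_def using runs.NPut by fastforce
next
  case (RPut a e f)
  then show ?case unfolding halts_def using runs.RPut by fastforce
next
  case (Seq c d)
  show ?case unfolding worst.simps
    by (rule halts_Seq[where R = "\<lambda>s'. s' = exec c s"]) (use Seq in auto)
next
  case (Cond b c d)
  show ?case unfolding worst.simps by (rule halts_Cond[OF _ _ order_refl]) (use Cond in auto)
qed auto

lemma halts_exec:
  "loop_free c \<Longrightarrow> worst c \<le> T \<Longrightarrow> Q (exec c s) \<Longrightarrow> halts c T s Q"
  using halts_mono[OF halts_worst] by blast

abbreviation nvar :: "string \<Rightarrow> nexp" where "nvar a \<equiv> NGet a (NConst 0)"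
abbreviation rvar :: "string \<Rightarrow> rexp" where "rvar a \<equiv> RGet a (NConst 0)"
abbreviation nlet :: "string \<Rightarrow> nexp \<Rightarrow> com" where "nlet a e \<equiv> NPut a (NConst 0) e"
abbreviation rlet :: "string \<Rightarrow> rexp \<Rightarrow> com" where "rlet a e \<equiv> RPut a (NConst 0) e"

definition For :: "string \<Rightarrow> string \<Rightarrow> com \<Rightarrow> com" where
  "For v e c = Seq (nlet v (NConst 0))
     (Loop (NLess (nvar v) (nvar e)) (Seq (nlet v (NPlus (nvar v) (NConst 1))) c))"

lemma nwrites_For [simp]: "nwrites (For v e c) = insert v (nwrites c)"
  and rwrites_For [simp]: "rwrites (For v e c) = rwrites c"
  by (auto simp: For_def)

lemma halts_For:
  assumes v: "v \<notin> nwrites c" and e: "e \<noteq> v" "e \<notin> nwrites c" and n: "fst s e 0 = n"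
    and init: "Inv 0 (nput v 0 0 s)"
    and step: "\<And>i s'. i < n \<Longrightarrow> Inv i s' \<Longrightarrow> framed (For v e c) s s' \<Longrightarrow>
                 halts c T (nput v 0 (Suc i) s') (Inv (Suc i))"
  shows "halts (For v e c) (8 + n * (T + 11)) s (Inv n)"
proof -
  let ?b = "NLess (nvar v) (nvar e)" and ?d = "Seq (nlet v (NPlus (nvar v) (NConst 1))) c"
  have loop: "halts (Loop ?b ?d) (5 + (n - i) * (T + 11)) s' (Inv n)"
    if "i \<le> n" "Inv i s'" "framed (For v e c) s s'" "fst s' v 0 = i" for i s'
    using that
  proof (induction i arbitrary: s' rule: inc_induct)
    case base
    have "\<not> bval ?b s'" using base e n by (simp add: framed_def)
    then have "runs (Loop ?b ?d) s' (bcost ?b) s'" by (rule runs.LoopFalse)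
    then show ?case unfolding halts_def using base by (intro exI[of _ "bcost ?b"] exI[of _ s']) auto
  next
    case (step i)
    have b: "bval ?b s'" using step e n by (simp add: framed_def)
    have "halts ?d (6 + T) s' (\<lambda>s''. Inv (Suc i) s'' \<and> framed c (nput v 0 (Suc i) s') s'')"
    proof (rule halts_Seq[where R = "\<lambda>s''. s'' = nput v 0 (Suc i) s'"])
      show "halts (nlet v (NPlus (nvar v) (NConst 1))) 6 s' (\<lambda>s''. s'' = nput v 0 (Suc i) s')"
        by (rule halts_exec) (use step(6) in auto)
      show "halts c T s'' (\<lambda>s''. Inv (Suc i) s'' \<and> framed c (nput v 0 (Suc i) s') s'')"
        if "s'' = nput v 0 (Suc i) s'" for s''
        using halts_framed[OF assms(6)[OF \<open>i < n\<close> step(4,5)]] that by simp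
    qed
    then obtain t s'' where t: "runs ?d s' t s''" "t \<le> 6 + T" "Inv (Suc i) s''"
      "framed c (nput v 0 (Suc i) s') s''" by (auto simp: halts_def)
    have "halts (Loop ?b ?d) (5 + (n - Suc i) * (T + 11)) s'' (Inv n)"
      using step.IH[OF t(3)] t(4) step.prems v unfolding framed_def by auto
    then obtain u s3 where u: "runs (Loop ?b ?d) s'' u s3" "u \<le> 5 + (n - Suc i) * (T + 11)" "Inv n s3"
      by (auto simp: halts_def)
    have "5 + (6 + T) + (5 + (n - Suc i) * (T + 11)) = 5 + (n - i) * (T + 11)"
      using \<open>i < n\<close> by (simp add: Suc_diff_Suc[symmetric])
    then show ?case unfolding halts_def
      using runs.LoopTrue[OF b t(1) u(1)] t(2) u(2,3)
      by (intro exI[of _ "bcost ?b + t + u"] exI[of _ s3]) auto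
  qed
  have "halts (For v e c) (3 + (5 + (n - 0) * (T + 11))) s (Inv n)"
    unfolding For_def
  proof (rule halts_Seq[where R = "\<lambda>s'. s' = nput v 0 0 s"])
    show "halts (nlet v (NConst 0)) 3 s (\<lambda>s'. s' = nput v 0 0 s)"
      by (rule halts_exec) auto
    show "halts (Loop ?b ?d) (5 + (n - 0) * (T + 11)) s' (Inv n)" if "s' = nput v 0 0 s" for s'
      using that init by (intro loop) (auto simp: framed_def)
  qed
  then show ?thesis by simp
qed

definition top_set :: "nat \<Rightarrow> nat \<Rightarrow> (nat \<Rightarrow> real) \<Rightarrow> nat set \<Rightarrow> bool" where
  "top_set m t \<kappa> S \<longleftrightarrow> S \<subseteq> {1..m} \<and> card S = min m t \<and> (\<forall>i \<in> S. \<forall>j \<in> {1..m} - S. \<kappa> j \<le> \<kappa> i)"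

definition pick :: "string \<Rightarrow> string \<Rightarrow> string \<Rightarrow> com \<Rightarrow> com" where
  "pick X J K c = Seq (nlet K (NConst 0))
     (For J ''m'' (Cond (NLess (NGet X (nvar J)) (NConst 1))
        (Cond (NLess (nvar K) (NConst 1)) (nlet K (nvar J)) c) Skip))"

text \<open>
  When no unmarked location is left, \<open>pick\<close> returns 0. The cell \<open>X 0\<close> that is then marked belongs to
  no location.
\<close>

definition select :: "string \<Rightarrow> string \<Rightarrow> string \<Rightarrow> string \<Rightarrow> com \<Rightarrow> com" where
  "select X T J K c = Seq (For J ''m'' (NPut X (nvar J) (NConst 0)))
     (For T ''r'' (Seq (pick X J K c) (NPut X (nvar K) (NConst 1))))"

lemma nwrites_pick [simp]: "nwrites (pick X J K c) = {J, K} \<union> nwrites c"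
  and rwrites_pick [simp]: "rwrites (pick X J K c) = rwrites c"
  and nwrites_select [simp]: "nwrites (select X T J K c) = {X, T, J, K} \<union> nwrites c"
  and rwrites_select [simp]: "rwrites (select X T J K c) = rwrites c"
  by (auto simp: pick_def select_def)

definition updates_best ::
  "string \<Rightarrow> string \<Rightarrow> nat \<Rightarrow> (nat \<Rightarrow> real) \<Rightarrow> com \<Rightarrow> nat \<Rightarrow> state \<Rightarrow> bool" where
  "updates_best J K m \<kappa> c T s \<longleftrightarrow>
     (\<forall>j p. j \<in> {1..m} \<longrightarrow> p \<in> {1..m} \<longrightarrow> fst s J 0 = j \<longrightarrow> fst s K 0 = p \<longrightarrow>
       halts c T s (\<lambda>s'. fst s' K 0 = (if \<kappa> p < \<kappa> j then j else p)))"

lemma halts_pick: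
  assumes dist: "distinct [X, J, K, ''m'']" "{X, J, ''m''} \<inter> nwrites c = {}"
    and m: "fst s ''m'' 0 = m"
    and c: "\<And>s'. framed (pick X J K c) s s' \<Longrightarrow> updates_best J K m \<kappa> c T s'"
  shows "halts (pick X J K c) (11 + m * (T + 27)) s
    (\<lambda>s'. let U = {l \<in> {1..m}. fst s X l = 0}; p = fst s' K 0 in
       if U = {} then p = 0 else p \<in> U \<and> (\<forall>j \<in> U. \<kappa> j \<le> \<kappa> p))"
proof -
  define U where "U i = {l \<in> {1..i}. fst s X l = 0}" for i
  define Inv where "Inv i s' \<longleftrightarrow> (if U i = {} then fst s' K 0 = 0
     else fst s' K 0 \<in> U i \<and> (\<forall>j \<in> U i. \<kappa> j \<le> \<kappa> (fst s' K 0)))" for i and s' :: state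
  let ?d = "Cond (NLess (nvar K) (NConst 1)) (nlet K (nvar J)) c"
  let ?b = "Cond (NLess (NGet X (nvar J)) (NConst 1)) ?d Skip"
  have U_Suc: "U (Suc i) = (if fst s X (Suc i) = 0 then insert (Suc i) (U i) else U i)" for i
    by (auto simp: U_def le_Suc_eq)
  have "halts (pick X J K c) (3 + (8 + m * ((T + 16) + 11))) s (Inv m)"
    unfolding pick_def
  proof (rule halts_Seq[where R = "\<lambda>s'. s' = nput K 0 0 s"])
    show "halts (nlet K (NConst 0)) 3 s (\<lambda>s'. s' = nput K 0 0 s)"
      by (rule halts_exec) auto
    fix s1 assume s1: "s1 = nput K 0 0 s"
    show "halts (For J ''m'' ?b) (8 + m * ((T + 16) + 11)) s1 (Inv m)"
    proof (rule halts_For)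
      show "J \<notin> nwrites ?b" "''m'' \<noteq> J" "''m'' \<notin> nwrites ?b" "fst s1 ''m'' 0 = m"
        using dist m s1 by auto
      show "Inv 0 (nput J 0 0 s1)" using dist s1 by (auto simp: Inv_def U_def)
      fix i s2 assume i: "i < m" and inv: "Inv i s2" and fr: "framed (For J ''m'' ?b) s1 s2"
      let ?s = "nput J 0 (Suc i) s2"
      have fr': "framed (pick X J K c) s ?s"
        using fr s1 by (auto simp: framed_def)
      have X: "fst ?s X = fst s X" using fr s1 dist by (auto simp: framed_def)
      have J: "fst ?s J 0 = Suc i" and K: "fst ?s K 0 = fst s2 K 0" using dist by auto
      show "halts ?b (T + 16) ?s (Inv (Suc i))"
      proof (rule halts_Cond)
        show "bcost (NLess (NGet X (nvar J)) (NConst 1)) + max (4 + max 5 T) 1 \<le> T + 16" by simp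
      next
        assume "bval (NLess (NGet X (nvar J)) (NConst 1)) ?s"
        then have X0: "fst s X (Suc i) = 0" using X J by simp
        show "halts ?d (4 + max 5 T) ?s (Inv (Suc i))"
        proof (cases "U i = {}")
          case True
          then have "bval (NLess (nvar K) (NConst 1)) ?s" "Inv (Suc i) (nput K 0 (Suc i) ?s)"
            using inv J dist X0 by (auto simp: Inv_def U_Suc)
          then show ?thesis
            by (intro halts_Cond[where T = 5 and U = T]) (auto intro: halts_exec)
        next
          case False
          define p where "p = fst s2 K 0"
          have p: "p \<in> U i" "\<forall>j \<in> U i. \<kappa> j \<le> \<kappa> p" using inv False by (auto simp: Inv_def p_def)
          have "halts c T ?s (\<lambda>s'. fst s' K 0 = (if \<kappa> p < \<kappa> (Suc i) then Suc i else p))"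
            using c[OF fr'] i J K p unfolding updates_best_def by (auto simp: U_def p_def)
          then have "halts c T ?s (Inv (Suc i))"
            by (rule halts_mono) (use p X0 in \<open>auto simp: Inv_def U_Suc\<close>)
          moreover have "\<not> bval (NLess (nvar K) (NConst 1)) ?s" using p K by (auto simp: p_def U_def)
          ultimately show ?thesis
            by (intro halts_Cond[where T = 5 and U = T]) auto
        qed
      next
        assume "\<not> bval (NLess (NGet X (nvar J)) (NConst 1)) ?s"
        then have "fst s X (Suc i) \<noteq> 0" using X J by simp
        then have "Inv (Suc i) ?s" using inv K by (simp add: Inv_def U_Suc)
        then show "halts Skip 1 ?s (Inv (Suc i))" by (intro halts_exec) auto
      qed
    qed
  qed
  then show ?thesis
    by (rule halts_mono) (simp, simp only: Inv_def U_def Let_def)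
qed

lemma framed_trans:
  assumes "framed c s s'" "framed d s' s''" "nwrites d \<subseteq> nwrites c" "rwrites d \<subseteq> rwrites c"
  shows "framed c s s''"
  using assms unfolding framed_def by (metis subsetD)

lemma top_set_insert:
  assumes "top_set m t \<kappa> S" "p \<in> {1..m} - S" "\<forall>j \<in> {1..m} - S. \<kappa> j \<le> \<kappa> p"
  shows "top_set m (Suc t) \<kappa> (insert p S)"
proof -
  have "finite S" using assms(1) finite_subset by (auto simp: top_set_def)
  moreover have "card S < card {1..m}"
    using assms(1,2) by (intro psubset_card_mono) (auto simp: top_set_def)
  ultimately show ?thesis using assms by (auto simp: top_set_def)
qed

lemma top_set_full:
  assumes "top_set m t \<kappa> S" "{1..m} - S = {}"
  shows "top_set m (Suc t) \<kappa> S"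
proof -
  have "S = {1..m}" using assms by (auto simp: top_set_def)
  then show ?thesis using assms by (auto simp: top_set_def)
qed

lemma halts_select:
  assumes dist: "distinct [X, T, J, K, ''m'', ''r'']" "{X, T, J, ''m'', ''r''} \<inter> nwrites c = {}"
    and m: "fst s ''m'' 0 = m" and r: "fst s ''r'' 0 = r"
    and c: "\<And>s'. framed (select X T J K c) s s' \<Longrightarrow> 1 \<le> r \<Longrightarrow> updates_best J K m \<kappa> c U s'"
  shows "halts (select X T J K c) (16 + m * 15 + r * (26 + m * (U + 27))) s
    (\<lambda>s'. \<exists>S. top_set m r \<kappa> S \<and> (\<forall>l \<in> {1..m}. fst s' X l = (if l \<in> S then 1 else 0)))"
proof -
  define Marks where "Marks t s' \<longleftrightarrow>
    (\<exists>S. top_set m t \<kappa> S \<and> (\<forall>l \<in> {1..m}. fst s' X l = (if l \<in> S then 1 else 0)))"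
    for t :: nat and s' :: state
  let ?c = "select X T J K c"
  let ?w = "NPut X (nvar J) (NConst 0)"
  let ?d = "Seq (pick X J K c) (NPut X (nvar K) (NConst 1))"
  have "halts ?c ((8 + m * (4 + 11)) + (8 + r * (((11 + m * (U + 27)) + 4) + 11))) s (Marks r)"
    unfolding select_def
  proof (rule halts_Seq)
    show "halts (For J ''m'' ?w) (8 + m * (4 + 11)) s (\<lambda>s'. \<forall>l \<in> {1..m}. fst s' X l = 0)"
    proof (rule halts_For[where Inv = "\<lambda>i s'. \<forall>l \<in> {1..i}. fst s' X l = 0"])
      fix i and s' :: state assume "\<forall>l \<in> {1..i}. fst s' X l = 0"
      then show "halts ?w 4 (nput J 0 (Suc i) s') (\<lambda>s'. \<forall>l \<in> {1..Suc i}. fst s' X l = 0)"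
        using dist by (intro halts_exec) (auto simp: le_Suc_eq)
    qed (use dist m in auto)
    fix s1 assume X0: "\<forall>l \<in> {1..m}. fst s1 X l = 0" and fr1: "framed (For J ''m'' ?w) s s1"
    have m1: "fst s1 ''m'' 0 = m" and r1: "fst s1 ''r'' 0 = r"
      using fr1 dist m r by (auto simp: framed_def)
    show "halts (For T ''r'' ?d) (8 + r * (((11 + m * (U + 27)) + 4) + 11)) s1 (Marks r)"
    proof (rule halts_For)
      show "T \<notin> nwrites ?d" "''r'' \<noteq> T" "''r'' \<notin> nwrites ?d" "fst s1 ''r'' 0 = r"
        using dist r1 by auto
      show "Marks 0 (nput T 0 0 s1)" using X0 dist by (auto simp: Marks_def top_set_def)
      fix i s2 assume i: "i < r" and inv: "Marks i s2" and fr2: "framed (For T ''r'' ?d) s1 s2"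
      let ?s = "nput T 0 (Suc i) s2"
      have fr: "framed ?c s ?s"
        using fr1 fr2 by (auto simp: framed_def)
      obtain S where S: "top_set m i \<kappa> S" "\<forall>l \<in> {1..m}. fst ?s X l = (if l \<in> S then 1 else 0)"
        using inv dist by (auto simp: Marks_def)
      have U: "{l \<in> {1..m}. fst ?s X l = 0} = {1..m} - S" using S(2) by auto
      show "halts ?d ((11 + m * (U + 27)) + 4) ?s (Marks (Suc i))"
      proof (rule halts_Seq)
        show "halts (pick X J K c) (11 + m * (U + 27)) ?s
          (\<lambda>s'. let U = {1..m} - S; p = fst s' K 0 in
             if U = {} then p = 0 else p \<in> U \<and> (\<forall>j \<in> U. \<kappa> j \<le> \<kappa> p))"
          unfolding U[symmetric]
        proof (rule halts_pick)
          show "fst ?s ''m'' 0 = m" using fr m dist by (auto simp: framed_def)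
          show "updates_best J K m \<kappa> c U s'" if "framed (pick X J K c) ?s s'" for s'
            using framed_trans[OF fr that] i by (intro c) auto
        qed (use dist in auto)
        fix s3
        assume p: "let U = {1..m} - S; p = fst s3 K 0 in
             if U = {} then p = 0 else p \<in> U \<and> (\<forall>j \<in> U. \<kappa> j \<le> \<kappa> p)"
          and fr3: "framed (pick X J K c) ?s s3"
        define p where "p = fst s3 K 0"
        have S3: "\<forall>l \<in> {1..m}. fst s3 X l = (if l \<in> S then 1 else 0)"
          using S(2) fr3 dist by (auto simp: framed_def)
        have "Marks (Suc i) (nput X p 1 s3)"
        proof (cases "{1..m} - S = {}")
          case True
          then have "p = 0" using p by (simp add: p_def)
          then show ?thesis using top_set_full[OF S(1) True] S3 by (auto simp: Marks_def)
        next
          case False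
          then have "p \<in> {1..m} - S" "\<forall>j \<in> {1..m} - S. \<kappa> j \<le> \<kappa> p"
            using p by (auto simp: p_def Let_def)
          from top_set_insert[OF S(1) this] show ?thesis
            using S3 unfolding Marks_def by (intro exI[of _ "insert p S"]) auto
        qed
        then show "halts (NPut X (nvar K) (NConst 1)) 4 s3 (Marks (Suc i))"
          by (intro halts_exec) (auto simp: p_def)
      qed
    qed
  qed
  then show ?thesis
    by (rule halts_mono) (auto simp: Marks_def algebra_simps)
qed

section \<open>Parametric search for the best ratio\<close>

lemma sum_le_exchange:
  fixes \<kappa> :: "'a \<Rightarrow> real"
  assumes fin: "finite S" "finite S'" and eq: "card S' = card S"
    and le: "\<And>i j. i \<in> S - S' \<Longrightarrow> j \<in> S' - S \<Longrightarrow> \<kappa> j \<le> \<kappa> i"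
  shows "sum \<kappa> S' \<le> sum \<kappa> S"
proof -
  have card: "card (S' - S) = card (S - S')"
  proof -
    have "card (S' - S) = card S' - card (S' \<inter> S)" "card (S - S') = card S - card (S \<inter> S')"
      using fin by (auto intro: card_Diff_subset_Int)
    then show ?thesis using eq by (simp add: Int_commute)
  qed
  then obtain f where f: "bij_betw f (S' - S) (S - S')"
    using fin finite_same_card_bij[of "S' - S" "S - S'"] by auto
  have "sum \<kappa> (S' - S) \<le> (\<Sum>i \<in> S' - S. \<kappa> (f i))"
  proof (rule sum_mono)
    fix i assume i: "i \<in> S' - S"
    then have "f i \<in> S - S'" using f by (auto simp: bij_betw_def)
    then show "\<kappa> i \<le> \<kappa> (f i)" using i le by blast
  qed
  also have "\<dots> = sum \<kappa> (S - S')" by (rule sum.reindex_bij_betw[OF f])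
  finally show ?thesis
    using sum.Int_Diff[OF fin(1), of \<kappa> S'] sum.Int_Diff[OF fin(2), of \<kappa> S] by (simp add: Int_commute)
qed

lemma top_set_sum:
  assumes "top_set m t \<kappa> S" "S' \<subseteq> {1..m}" "card S' = min m t"
  shows "sum \<kappa> S' \<le> sum \<kappa> S"
  using assms finite_subset by (intro sum_le_exchange) (auto simp: top_set_def)

lemma top_set_cong:
  assumes "\<And>i. i \<in> {1..m} \<Longrightarrow> \<kappa> i = \<kappa>' i"
  shows "top_set m t \<kappa> S \<longleftrightarrow> top_set m t \<kappa>' S"
  unfolding top_set_def using assms by (metis DiffD1 subsetD)

definition best_ratio :: "nat \<Rightarrow> nat \<Rightarrow> (nat \<Rightarrow> real) \<Rightarrow> (nat \<Rightarrow> real) \<Rightarrow> real \<Rightarrow> real" where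
  "best_ratio m r a b B = Max ((\<lambda>S. sum a S / (B + sum b S)) ` {S. S \<subseteq> {1..m} \<and> card S = min m r})"

lemma best_ratio_cong:
  assumes "\<And>i. i \<in> {1..m} \<Longrightarrow> a i = a' i" "\<And>i. i \<in> {1..m} \<Longrightarrow> b i = b' i"
  shows "best_ratio m r a b B = best_ratio m r a' b' B"
proof -
  have "sum a S = sum a' S" "sum b S = sum b' S" if "S \<subseteq> {1..m}" for S
    using that assms by (auto intro!: sum.cong)
  then show ?thesis unfolding best_ratio_def by (intro arg_cong[where f = Max] image_cong) auto
qed

lemma best_ratio_cases:
  fixes \<mu> :: real
  assumes pos: "1 \<le> m" "1 \<le> r" "0 \<le> B" "\<And>i. i \<in> {1..m} \<Longrightarrow> 0 < b i"
    and S: "top_set m r (\<lambda>l. a l - \<mu> * b l) S"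
  defines "h \<equiv> (\<Sum>l \<in> S. a l - \<mu> * b l) - \<mu> * B"
  shows "h < 0 \<longleftrightarrow> best_ratio m r a b B < \<mu>" "0 < h \<longleftrightarrow> \<mu> < best_ratio m r a b B"
proof -
  let ?R = "{S. S \<subseteq> {1..m} \<and> card S = min m r}"
  let ?h = "\<lambda>S. (\<Sum>l \<in> S. a l - \<mu> * b l) - \<mu> * B" and ?q = "\<lambda>S. sum a S / (B + sum b S)"
  have fin: "finite ?R" by (rule finite_subset[of _ "Pow {1..m}"]) auto
  have SR: "S \<in> ?R" using S by (auto simp: top_set_def)
  have D: "0 < B + sum b S'" if "S' \<in> ?R" for S'
  proof -
    have "S' \<noteq> {}" "finite S'" using that pos finite_subset by (force, auto)
    then have "0 < sum b S'" using that pos(4) by (intro sum_pos) auto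
    then show ?thesis using pos(3) by simp
  qed
  have h: "?h S' = sum a S' - \<mu> * (B + sum b S')" for S'
    by (simp add: sum_subtractf sum_distrib_left algebra_simps)
  have le: "?h S' \<le> h" if "S' \<in> ?R" for S'
    using top_set_sum[OF S, of S'] that by (simp add: h_def)
  have q: "?h S' < 0 \<longleftrightarrow> ?q S' < \<mu>" "0 < ?h S' \<longleftrightarrow> \<mu> < ?q S'" if "S' \<in> ?R" for S'
    unfolding h using D[OF that] by (auto simp: field_simps)
  have Max: "best_ratio m r a b B < \<mu> \<longleftrightarrow> (\<forall>S' \<in> ?R. ?q S' < \<mu>)"
    "\<mu> < best_ratio m r a b B \<longleftrightarrow> (\<exists>S' \<in> ?R. \<mu> < ?q S')"
    using Max_less_iff[of "?q ` ?R" \<mu>] Max_gr_iff[of "?q ` ?R" \<mu>] fin SR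
    unfolding best_ratio_def by blast+
  show "h < 0 \<longleftrightarrow> best_ratio m r a b B < \<mu>"
  proof -
    have "h < 0 \<longleftrightarrow> (\<forall>S' \<in> ?R. ?h S' < 0)" using le SR unfolding h_def by (blast intro: le_less_trans)
    then show ?thesis unfolding Max using q(1) by blast
  qed
  show "0 < h \<longleftrightarrow> \<mu> < best_ratio m r a b B"
  proof -
    have "0 < h \<longleftrightarrow> (\<exists>S' \<in> ?R. 0 < ?h S')" using le SR unfolding h_def by (blast intro: less_le_trans)
    then show ?thesis unfolding Max using q(2) by blast
  qed
qed

definition gain_exp :: "nexp \<Rightarrow> rexp" where
  "gain_exp l = RMinus (RGet ''a'' l) (RTimes (rvar ''mu'') (RGet ''b'' l))"

definition compare_gain :: com where
  "compare_gain = Cond (RLess (gain_exp (nvar ''o'')) (gain_exp (nvar ''l''))) (nlet ''o'' (nvar ''l'')) Skip"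

definition oracle_sum :: com where
  "oracle_sum = Seq (rlet ''h'' (RMinus (RConst 0) (RTimes (rvar ''mu'') (rvar ''B''))))
     (For ''l'' ''m'' (Cond (NLess (NConst 0) (NGet ''y'' (nvar ''l'')))
        (rlet ''h'' (RPlus (rvar ''h'') (gain_exp (nvar ''l'')))) Skip))"

definition sign_oracle :: com where
  "sign_oracle = Seq (select ''y'' ''u'' ''l'' ''o'' compare_gain) oracle_sum"

lemma writes_oracle [simp]:
  "nwrites compare_gain = {''o''}" "rwrites compare_gain = {}"
  "nwrites sign_oracle = {''y'', ''u'', ''l'', ''o''}" "rwrites sign_oracle = {''h''}"
  by (auto simp: compare_gain_def sign_oracle_def oracle_sum_def)

lemma halts_oracle_sum:
  assumes "fst s ''m'' 0 = m" and S: "S \<subseteq> {1..m}"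
    and y: "\<forall>l \<in> {1..m}. fst s ''y'' l = (if l \<in> S then 1 else 0)"
    and \<kappa>: "\<kappa> = (\<lambda>l. snd s ''a'' l - snd s ''mu'' 0 * snd s ''b'' l)"
  shows "halts oracle_sum (17 + m * 31) s (\<lambda>s'. snd s' ''h'' 0 = sum \<kappa> S - snd s ''mu'' 0 * snd s ''B'' 0)"
proof -
  let ?mu = "snd s ''mu'' 0" and ?B = "snd s ''B'' 0"
  let ?i = "rlet ''h'' (RMinus (RConst 0) (RTimes (rvar ''mu'') (rvar ''B'')))"
  let ?d = "Cond (NLess (NConst 0) (NGet ''y'' (nvar ''l'')))
        (rlet ''h'' (RPlus (rvar ''h'') (gain_exp (nvar ''l'')))) Skip"
  define Inv where "Inv i s' \<longleftrightarrow> snd s' ''h'' 0 = sum \<kappa> (S \<inter> {1..i}) - ?mu * ?B" for i and s' :: state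
  have "halts oracle_sum (9 + (8 + m * (20 + 11))) s (Inv m)"
    unfolding oracle_sum_def
  proof (rule halts_Seq)
    show "halts ?i 9 s (Inv 0)" by (rule halts_exec) (auto simp: Inv_def)
    fix s1 assume s1: "Inv 0 s1" "framed ?i s s1"
    show "halts (For ''l'' ''m'' ?d) (8 + m * (20 + 11)) s1 (Inv m)"
    proof (rule halts_For)
      fix i s2 assume i: "i < m" and inv: "Inv i s2" and fr: "framed (For ''l'' ''m'' ?d) s1 s2"
      have "snd s2 ''a'' = snd s ''a''" "snd s2 ''b'' = snd s ''b''" "snd s2 ''mu'' = snd s ''mu''"
        "fst s2 ''y'' (Suc i) = (if Suc i \<in> S then 1 else 0)"
        using s1(2) fr y i by (auto simp: framed_def)
      moreover have "S \<inter> {1..Suc i} = (if Suc i \<in> S then insert (Suc i) (S \<inter> {1..i}) else S \<inter> {1..i})"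
        by (auto simp: le_Suc_eq)
      ultimately show "halts ?d 20 (nput ''l'' 0 (Suc i) s2) (Inv (Suc i))"
        using inv by (intro halts_exec) (auto simp: Inv_def gain_exp_def \<kappa> split: if_splits)
    qed (use s1 assms in \<open>auto simp: framed_def Inv_def\<close>)
  qed
  then show ?thesis
    by (rule halts_mono) (use S in \<open>auto simp: Inv_def Int_absorb2\<close>)
qed

lemma halts_sign_oracle:
  assumes m: "fst s ''m'' 0 = m" and r: "fst s ''r'' 0 = r"
    and \<kappa>: "\<kappa> = (\<lambda>l. snd s ''a'' l - snd s ''mu'' 0 * snd s ''b'' l)"
  shows "halts sign_oracle (33 + m * 46 + r * (26 + m * 52)) s
    (\<lambda>s'. \<exists>S. top_set m r \<kappa> S \<and> snd s' ''h'' 0 = sum \<kappa> S - snd s ''mu'' 0 * snd s ''B'' 0)"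
proof -
  let ?Q = "\<lambda>s'. \<exists>S. top_set m r \<kappa> S \<and> snd s' ''h'' 0 = sum \<kappa> S - snd s ''mu'' 0 * snd s ''B'' 0"
  let ?c = "select ''y'' ''u'' ''l'' ''o'' compare_gain"
  have "halts sign_oracle ((16 + m * 15 + r * (26 + m * (25 + 27))) + (17 + m * 31)) s ?Q"
    unfolding sign_oracle_def
  proof (rule halts_Seq[OF halts_select[OF _ _ m r]])
    fix s' assume "framed ?c s s'"
    then have "snd s' ''a'' = snd s ''a''" "snd s' ''b'' = snd s ''b''"
      "snd s' ''mu'' = snd s ''mu''" by (auto simp: framed_def)
    then show "updates_best ''l'' ''o'' m \<kappa> compare_gain 25 s'"
      unfolding updates_best_def compare_gain_def
      by (auto intro!: halts_exec simp: gain_exp_def \<kappa>)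
  next
    fix s1
    assume "\<exists>S. top_set m r \<kappa> S \<and> (\<forall>l \<in> {1..m}. fst s1 ''y'' l = (if l \<in> S then 1 else 0))"
      and fr: "framed ?c s s1"
    then obtain S where S: "top_set m r \<kappa> S" "\<forall>l \<in> {1..m}. fst s1 ''y'' l = (if l \<in> S then 1 else 0)"
      by blast
    have "halts oracle_sum (17 + m * 31) s1
        (\<lambda>s'. snd s' ''h'' 0 = sum \<kappa> S - snd s1 ''mu'' 0 * snd s1 ''B'' 0)"
      using fr m S by (intro halts_oracle_sum) (auto simp: framed_def \<kappa> top_set_def)
    then show "halts oracle_sum (17 + m * 31) s1 ?Q"
      by (rule halts_mono) (use S fr in \<open>auto simp: framed_def\<close>)
  qed auto
  then show ?thesis by (rule halts_mono) (auto simp: algebra_simps)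
qed

definition compare_optimal :: com where
  "compare_optimal = Seq
     (rlet ''mu'' (RDivide (RMinus (RGet ''a'' (nvar ''j'')) (RGet ''a'' (nvar ''p'')))
        (RMinus (RGet ''b'' (nvar ''j'')) (RGet ''b'' (nvar ''p'')))))
     (Seq sign_oracle
       (Cond (RLess (RGet ''b'' (nvar ''p'')) (RGet ''b'' (nvar ''j'')))
         (Cond (RLess (rvar ''h'') (RConst 0)) (nlet ''p'' (nvar ''j'')) Skip)
       (Cond (RLess (RGet ''b'' (nvar ''j'')) (RGet ''b'' (nvar ''p'')))
         (Cond (RLess (RConst 0) (rvar ''h'')) (nlet ''p'' (nvar ''j'')) Skip)
         (Cond (RLess (RGet ''a'' (nvar ''p'')) (RGet ''a'' (nvar ''j''))) (nlet ''p'' (nvar ''j'')) Skip))))"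

definition optimize :: com where
  "optimize = select ''x'' ''t'' ''j'' ''p'' compare_optimal"

lemma writes_compare_optimal [simp]:
  "nwrites compare_optimal = {''y'', ''u'', ''l'', ''o'', ''p''}" "rwrites compare_optimal = {''mu'', ''h''}"
  by (auto simp: compare_optimal_def)

lemma less_iff_ratio:
  fixes a a' b b' \<rho> :: real
  shows "a - \<rho> * b < a' - \<rho> * b' \<longleftrightarrow>
    (if b < b' then \<rho> < (a' - a) / (b' - b) else if b' < b then (a' - a) / (b' - b) < \<rho> else a < a')"
proof -
  have "a - \<rho> * b < a' - \<rho> * b' \<longleftrightarrow> \<rho> * (b' - b) < a' - a" by (simp add: algebra_simps)
  then show ?thesis by (auto simp: pos_less_divide_eq neg_divide_less_eq)
qed

lemma halts_compare_optimal:
  assumes m: "fst s ''m'' 0 = m" and r: "fst s ''r'' 0 = r" "1 \<le> r"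
    and pos: "0 \<le> snd s ''B'' 0" "\<And>i. i \<in> {1..m} \<Longrightarrow> 0 < snd s ''b'' i"
  defines "\<rho> \<equiv> best_ratio m r (snd s ''a'') (snd s ''b'') (snd s ''B'' 0)"
  shows "updates_best ''j'' ''p'' m (\<lambda>l. snd s ''a'' l - \<rho> * snd s ''b'' l) compare_optimal
    (80 + m * 46 + r * (26 + m * 52)) s"
  unfolding updates_best_def
proof (intro allI impI)
  fix j p assume j: "j \<in> {1..m}" "fst s ''j'' 0 = j" and p: "p \<in> {1..m}" "fst s ''p'' 0 = p"
  let ?a = "snd s ''a''" and ?b = "snd s ''b''" and ?B = "snd s ''B'' 0"
  define \<mu> where "\<mu> = (?a j - ?a p) / (?b j - ?b p)"
  let ?Q = "\<lambda>s'. fst s' ''p'' 0 = (if ?a p - \<rho> * ?b p < ?a j - \<rho> * ?b j then j else p)"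
  have "halts compare_optimal (17 + ((33 + m * 46 + r * (26 + m * 52)) + 30)) s ?Q"
    unfolding compare_optimal_def
  proof (rule halts_Seq[where R = "\<lambda>s'. s' = rput ''mu'' 0 \<mu> s"], goal_cases)
    case 1
    show ?case by (rule halts_exec) (auto simp: \<mu>_def j p)
  next
    case (2 s1)
    note s1 = 2(1)
    show ?case
    proof (rule halts_Seq[where R = "\<lambda>s'. \<exists>S. top_set m r (\<lambda>l. ?a l - \<mu> * ?b l) S \<and>
          snd s' ''h'' 0 = (\<Sum>l \<in> S. ?a l - \<mu> * ?b l) - \<mu> * ?B"], goal_cases)
      case 1
      show ?case using halts_sign_oracle[of s1 m r, OF _ _ refl] s1 m r by simp
    next
      case (2 s2)
      then obtain S where S: "top_set m r (\<lambda>l. ?a l - \<mu> * ?b l) S"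
        "snd s2 ''h'' 0 = (\<Sum>l \<in> S. ?a l - \<mu> * ?b l) - \<mu> * ?B"
        using s1 by auto
      have h: "snd s2 ''h'' 0 < 0 \<longleftrightarrow> \<rho> < \<mu>" "0 < snd s2 ''h'' 0 \<longleftrightarrow> \<mu> < \<rho>"
        unfolding S(2) \<rho>_def using best_ratio_cases[OF _ r(2) pos S(1)] j by auto
      have eq: "snd s2 ''a'' = ?a" "snd s2 ''b'' = ?b" "fst s2 ''j'' 0 = j" "fst s2 ''p'' 0 = p"
        using 2(2) s1 j p by (auto simp: framed_def)
      show ?case
        by (rule halts_exec) (auto simp: eq h less_iff_ratio \<mu>_def)
    qed
  qed
  then show "halts compare_optimal (80 + m * 46 + r * (26 + m * 52)) s ?Q"
    by (rule halts_mono) auto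
qed

lemma halts_optimize:
  assumes m: "fst s ''m'' 0 = m" and r: "fst s ''r'' 0 = r"
    and pos: "0 \<le> snd s ''B'' 0" "\<And>i. i \<in> {1..m} \<Longrightarrow> 0 < snd s ''b'' i"
  defines "\<rho> \<equiv> best_ratio m r (snd s ''a'') (snd s ''b'') (snd s ''B'' 0)"
  shows "halts optimize (16 + m * 15 + r * (26 + m * (107 + m * 46 + r * (26 + m * 52)))) s
    (\<lambda>s'. \<exists>S. top_set m r (\<lambda>l. snd s ''a'' l - \<rho> * snd s ''b'' l) S \<and>
      (\<forall>l \<in> {1..m}. fst s' ''x'' l = (if l \<in> S then 1 else 0)))"
proof -
  have "halts optimize (16 + m * 15 + r * (26 + m * ((80 + m * 46 + r * (26 + m * 52)) + 27))) s
    (\<lambda>s'. \<exists>S. top_set m r (\<lambda>l. snd s ''a'' l - \<rho> * snd s ''b'' l) S \<and>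
      (\<forall>l \<in> {1..m}. fst s' ''x'' l = (if l \<in> S then 1 else 0)))"
    unfolding optimize_def
  proof (rule halts_select[OF _ _ m r])
    fix s' assume fr: "framed (select ''x'' ''t'' ''j'' ''p'' compare_optimal) s s'" and "1 \<le> r"
    have "snd s' ''a'' = snd s ''a''" "snd s' ''b'' = snd s ''b''" "snd s' ''B'' = snd s ''B''"
      "fst s' ''m'' = fst s ''m''" "fst s' ''r'' = fst s ''r''"
      using fr by (auto simp: framed_def)
    then show "updates_best ''j'' ''p'' m (\<lambda>l. snd s ''a'' l - \<rho> * snd s ''b'' l) compare_optimal
        (80 + m * 46 + r * (26 + m * 52)) s'"
      using halts_compare_optimal[of s' m r] \<open>1 \<le> r\<close> m r pos by (simp add: \<rho>_def)
  qed auto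
  then show ?thesis by (rule halts_mono) (auto simp: algebra_simps)
qed

section \<open>Marginal gains in a nest\<close>

definition prior :: "(nat \<Rightarrow> real) \<Rightarrow> nat \<Rightarrow> nat \<Rightarrow> bool" where
  "prior v j i \<longleftrightarrow> v i < v j \<or> v i = v j \<and> j < i"

lemma prior_trans: "prior v i j \<Longrightarrow> prior v j k \<Longrightarrow> prior v i k"
  and prior_asym: "prior v i j \<Longrightarrow> \<not> prior v j i"
  and prior_total: "i \<noteq> j \<Longrightarrow> prior v i j \<or> prior v j i"
  by (auto simp: prior_def)

lemma prior_first: "finite S \<Longrightarrow> S \<noteq> {} \<Longrightarrow> \<exists>i \<in> S. \<forall>j \<in> S - {i}. prior v i j"
proof (induction S rule: finite_ne_induct)
  case (insert x S)
  then obtain i where "i \<in> S" "\<forall>j \<in> S - {i}. prior v i j" by blast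
  then show ?case
    using prior_total[of x i v] prior_trans[of v x i] insert(3) by (cases "prior v x i") blast+
qed simp

lemma prior_last: "finite S \<Longrightarrow> S \<noteq> {} \<Longrightarrow> \<exists>i \<in> S. \<forall>j \<in> S - {i}. prior v j i"
proof (induction S rule: finite_ne_induct)
  case (insert x S)
  then obtain i where "i \<in> S" "\<forall>j \<in> S - {i}. prior v j i" by blast
  then show ?case
    using prior_total[of x i v] prior_trans[of v _ i x] insert(3) by (cases "prior v i x") blast+
qed simp

locale concave_gain =
  fixes v :: "nat \<Rightarrow> real" and L :: "nat set" and G :: "real \<Rightarrow> real" and c :: real
  assumes fin: "finite L" and v_pos: "\<And>i. 0 < v i"
    and decreasing: "\<And>u w d. c \<le> u \<Longrightarrow> u \<le> w \<Longrightarrow> 0 \<le> d \<Longrightarrow> G (w + d) - G w \<le> G (u + d) - G u"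
begin

definition base :: "nat \<Rightarrow> real" where
  "base i = c + sum v {j \<in> L. prior v j i}"

definition gain :: "nat \<Rightarrow> real" where
  "gain i = G (base i + v i) - G (base i)"

lemma sum_gain_le:
  assumes "S \<subseteq> L"
  shows "sum gain S \<le> G (c + sum v S) - G c"
  using finite_subset[OF assms fin] assms
proof (induction S rule: finite_psubset_induct)
  case (psubset S)
  show ?case
  proof (cases "S = {}")
    case False
    obtain i where i: "i \<in> S" "\<forall>j \<in> S - {i}. prior v j i"
      using prior_last[OF psubset(1) False] by blast
    let ?u = "c + sum v (S - {i})"
    have v_ge: "0 \<le> v j" for j using v_pos[of j] by simp
    have "?u \<le> base i"
      unfolding base_def using i psubset(3) fin v_ge by (intro add_left_mono sum_mono2) auto
    moreover have "c \<le> ?u" using v_ge by (simp add: sum_nonneg)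
    ultimately have "gain i \<le> G (?u + v i) - G ?u"
      unfolding gain_def using v_ge by (intro decreasing)
    moreover have "sum gain (S - {i}) \<le> G ?u - G c"
      using psubset.IH[of "S - {i}"] i psubset(3) by blast
    ultimately show ?thesis
      using sum.remove[OF psubset(1) i(1), of gain] sum.remove[OF psubset(1) i(1), of v]
      by (simp add: algebra_simps)
  qed simp
qed

lemma prefix_gain:
  "k \<le> card L \<Longrightarrow> \<exists>P \<subseteq> L. card P = k \<and> (\<forall>i \<in> P. \<forall>j \<in> L - P. prior v i j) \<and>
     sum gain P = G (c + sum v P) - G c"
proof (induction k)
  case 0
  show ?case by (rule exI[of _ "{}"]) simp
next
  case (Suc k)
  then obtain P where P: "P \<subseteq> L" "card P = k" "\<forall>i \<in> P. \<forall>j \<in> L - P. prior v i j"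
    "sum gain P = G (c + sum v P) - G c" by force
  have finP: "finite P" using P(1) fin by (rule finite_subset)
  have "L - P \<noteq> {}" using Suc.prems P finP card_mono[of P L] by auto
  then obtain i where i: "i \<in> L - P" "\<forall>j \<in> L - P - {i}. prior v i j"
    using prior_first[of "L - P" v] fin by auto
  have "{j \<in> L. prior v j i} = P"
    using P(1,3) i prior_asym[of v] by blast
  then have base: "base i = c + sum v P" by (simp add: base_def)
  show ?case
  proof (intro exI[of _ "insert i P"] conjI)
    show "sum gain (insert i P) = G (c + sum v (insert i P)) - G c"
      using finP i P(4) by (simp add: gain_def base algebra_simps)
  qed (use P i finP in auto)
qed

lemma sum_gain_ge:
  assumes "mono_on {c..} G" "S \<subseteq> L"
  shows "\<exists>P \<subseteq> L. card P = card S \<and> G (c + sum v S) - G c \<le> sum gain P"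
proof -
  have finS: "finite S" using assms(2) fin by (rule finite_subset)
  obtain P where P: "P \<subseteq> L" "card P = card S" "\<forall>i \<in> P. \<forall>j \<in> L - P. prior v i j"
    "sum gain P = G (c + sum v P) - G c"
    using prefix_gain card_mono[OF fin assms(2)] by blast
  have "sum v S \<le> sum v P"
  proof (rule sum_le_exchange)
    fix i j assume "i \<in> P - S" "j \<in> S - P"
    then have "prior v i j" using P(3) assms(2) by blast
    then show "v j \<le> v i" by (auto simp: prior_def)
  qed (use P(2) finS finite_subset[OF P(1) fin] in simp_all)
  moreover have "0 \<le> sum v S" using v_pos by (simp add: sum_nonneg less_imp_le)
  ultimately have "G (c + sum v S) \<le> G (c + sum v P)"
    by (intro mono_onD[OF assms(1)]) auto
  then show ?thesis using P(1,2,4) by (intro exI[of _ P]) simp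
qed

end

lemma powr_gain_decreasing:
  fixes \<sigma> c \<mu> :: real
  assumes \<sigma>: "0 < \<sigma>" "\<sigma> \<le> 1" and c: "0 \<le> c" and \<mu>: "\<mu> \<le> 1" and u: "c \<le> u" "u \<le> w" "0 \<le> d"
  defines "G \<equiv> \<lambda>x. x powr \<sigma> - c * x powr (\<sigma> - 1) - \<mu> * x powr \<sigma>"
  shows "G (w + d) - G w \<le> G (u + d) - G u"
proof (rule DERIV_nonpos_imp_decreasing_open[where f = "\<lambda>x. G (x + d) - G x"])
  fix x assume "u < x" "x < w"
  then have x: "0 < x" using u c by simp
  define D where "D y = (1 - \<mu>) * \<sigma> * y powr (\<sigma> - 1) + c * (1 - \<sigma>) * y powr (\<sigma> - 2)" for y
  have G: "(G has_real_derivative D y) (at y)" if "0 < y" for y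
    unfolding G_def D_def using that
    by (auto intro!: derivative_eq_intros simp: algebra_simps)
  have "((\<lambda>x. G (x + d)) has_real_derivative D (x + d)) (at x)"
    using DERIV_shift[of G "D (x + d)" x d] G[of "x + d"] x u by simp
  then have "((\<lambda>x. G (x + d) - G x) has_real_derivative D (x + d) - D x) (at x)"
    using G[OF x] by (rule DERIV_diff)
  moreover have "D (x + d) \<le> D x"
    unfolding D_def using x u \<sigma> c \<mu>
    by (intro add_mono mult_left_mono powr_mono2') auto
  ultimately show "\<exists>y. ((\<lambda>x. G (x + d) - G x) has_real_derivative y) (at x) \<and> y \<le> 0"
    by (intro exI[of _ "D (x + d) - D x"]) auto
next
  have G: "continuous_on {c..} G"
  proof (cases "c = 0")
    case True
    then show ?thesis unfolding G_def using \<sigma> by (auto intro!: continuous_intros continuous_on_powr')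
  next
    case False
    then show ?thesis unfolding G_def using c by (auto intro!: continuous_intros)
  qed
  have "continuous_on {u..w} (\<lambda>x. G (x + d))"
    by (rule continuous_on_compose2[OF G]) (use u in \<open>auto intro!: continuous_intros\<close>)
  moreover have "continuous_on {u..w} G"
    using G by (rule continuous_on_subset) (use u in auto)
  ultimately show "continuous_on {u..w} (\<lambda>x. G (x + d) - G x)"
    by (rule continuous_on_diff)
qed (use u in auto)

lemma powr_gain_mono:
  fixes \<sigma> c \<mu> :: real
  assumes \<sigma>: "0 < \<sigma>" "\<sigma> \<le> 1" and c: "0 \<le> c" and \<mu>: "\<mu> \<le> 1"
  shows "mono_on {c..} (\<lambda>x. x powr \<sigma> - c * x powr (\<sigma> - 1) - \<mu> * x powr \<sigma>)"
proof (rule mono_onI)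
  fix x y :: real assume xy: "x \<in> {c..}" "y \<in> {c..}" "x \<le> y"
  have "x powr \<sigma> \<le> y powr \<sigma>" using xy c \<sigma> by (intro powr_mono2) auto
  then have "(1 - \<mu>) * x powr \<sigma> \<le> (1 - \<mu>) * y powr \<sigma>" using \<mu> by (intro mult_left_mono) auto
  moreover have "c * y powr (\<sigma> - 1) \<le> c * x powr (\<sigma> - 1)"
  proof (cases "c = 0")
    case False
    then show ?thesis using xy c \<sigma> by (intro mult_left_mono powr_mono2') auto
  qed simp
  ultimately show "x powr \<sigma> - c * x powr (\<sigma> - 1) - \<mu> * x powr \<sigma> \<le> y powr \<sigma> - c * y powr (\<sigma> - 1) - \<mu> * y powr \<sigma>"
    by (simp add: algebra_simps)
qed

definition nest_locs :: "mcp_nl \<Rightarrow> nat \<Rightarrow> nat set" where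
  "nest_locs I n = {i \<in> locs I. nest_of I i = n}"

definition rival :: "mcp_nl \<Rightarrow> nat \<Rightarrow> real" where
  "rival I n = (\<Sum>i \<in> {i \<in> competitors I. nest_of I i = n}. V I i)"

definition prior_weight :: "mcp_nl \<Rightarrow> nat \<Rightarrow> real" where
  "prior_weight I i = rival I (nest_of I i) + sum (V I) {j \<in> nest_locs I (nest_of I i). prior (V I) j i}"

definition den_gain :: "mcp_nl \<Rightarrow> nat \<Rightarrow> real" where
  "den_gain I i = (let w = prior_weight I i; \<sigma> = dissim I (nest_of I i) in
     (w + V I i) powr \<sigma> - w powr \<sigma>)"

definition num_gain :: "mcp_nl \<Rightarrow> nat \<Rightarrow> real" where
  "num_gain I i = (let w = prior_weight I i; \<sigma> = dissim I (nest_of I i) in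
     den_gain I i - rival I (nest_of I i) * ((w + V I i) powr (\<sigma> - 1) - w powr (\<sigma> - 1)))"

definition base_den :: "mcp_nl \<Rightarrow> real" where
  "base_den I = (\<Sum>n = 1..num_nests I. rival I n powr dissim I n)"

definition weight :: "mcp_nl \<Rightarrow> nat set \<Rightarrow> nat \<Rightarrow> real" where
  "weight I S n = rival I n + (\<Sum>i \<in> {i \<in> S. nest_of I i = n}. V I i)"

definition denom :: "mcp_nl \<Rightarrow> nat set \<Rightarrow> real" where
  "denom I S = (\<Sum>n = 1..num_nests I. weight I S n powr dissim I n)"

definition numer :: "mcp_nl \<Rightarrow> nat set \<Rightarrow> real" where
  "numer I S = (\<Sum>n = 1..num_nests I. weight I S n powr dissim I n - rival I n * weight I S n powr (dissim I n - 1))"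

locale nl_instance =
  fixes I :: mcp_nl
  assumes inst: "mcp_nl_instance I"
begin

lemma finite_competitors: "finite (competitors I)"
  and demand_ge: "0 \<le> demand I"
  and dissim: "n \<in> {1..num_nests I} \<Longrightarrow> 0 < dissim I n \<and> dissim I n \<le> 1"
  using inst by (auto simp: mcp_nl_instance_def)

lemma finite_locs: "finite (locs I)"
  by (simp add: locs_def)

lemma finite_feasible: "finite (feasible I)"
  by (rule finite_subset[of _ "locs I \<rightarrow>\<^sub>E {0, 1}"]) (auto simp: feasible_def finite_locs intro!: finite_PiE)

lemma nest_of:
  assumes "i \<in> locs I \<union> competitors I"
  shows "nest_of I i \<in> {1..num_nests I}" "n \<in> {1..num_nests I} \<Longrightarrow> i \<in> nest I n \<longleftrightarrow> nest_of I i = n"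
proof -
  have ex: "\<exists>!n. n \<in> {1..num_nests I} \<and> i \<in> nest I n"
    using inst assms unfolding mcp_nl_instance_def by blast
  have th: "nest_of I i \<in> {1..num_nests I} \<and> i \<in> nest I (nest_of I i)"
    unfolding nest_of_def by (rule theI'[OF ex])
  then show "nest_of I i \<in> {1..num_nests I}" by blast
  show "i \<in> nest I n \<longleftrightarrow> nest_of I i = n" if "n \<in> {1..num_nests I}"
    using th ex that by blast
qed

lemma V_pos: "0 < V I i"
  by (simp add: V_def)

lemma rival_ge: "0 \<le> rival I n"
  unfolding rival_def by (intro sum_nonneg) (simp add: V_def)

lemma base_den_ge: "0 \<le> base_den I"
  unfolding base_den_def by (intro sum_nonneg) simp

lemma prior_weight_ge: "rival I (nest_of I i) \<le> prior_weight I i"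
  unfolding prior_weight_def using V_pos by (simp add: sum_nonneg less_imp_le)

definition G :: "real \<Rightarrow> nat \<Rightarrow> real \<Rightarrow> real" where
  "G \<mu> n x = x powr dissim I n - rival I n * x powr (dissim I n - 1) - \<mu> * x powr dissim I n"

lemma concave: "n \<in> {1..num_nests I} \<Longrightarrow> \<mu> \<le> 1 \<Longrightarrow> concave_gain (V I) (nest_locs I n) (G \<mu> n) (rival I n)"
  using powr_gain_decreasing[of "dissim I n" "rival I n" \<mu>] dissim V_pos rival_ge finite_locs
  by unfold_locales (auto simp: G_def nest_locs_def)

lemma mono: "n \<in> {1..num_nests I} \<Longrightarrow> \<mu> \<le> 1 \<Longrightarrow> mono_on {rival I n..} (G \<mu> n)"
  unfolding G_def using dissim rival_ge by (intro powr_gain_mono) auto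

lemma gain_eq:
  assumes "n \<in> {1..num_nests I}" "\<mu> \<le> 1" "i \<in> nest_locs I n"
  shows "concave_gain.gain (V I) (nest_locs I n) (G \<mu> n) (rival I n) i = num_gain I i - \<mu> * den_gain I i"
proof -
  interpret concave_gain "V I" "nest_locs I n" "G \<mu> n" "rival I n" using assms by (intro concave)
  have n: "nest_of I i = n" using assms by (simp add: nest_locs_def)
  then have "base i = prior_weight I i" by (simp add: base_def prior_weight_def)
  then show ?thesis
    by (simp add: gain_def G_def num_gain_def den_gain_def Let_def n algebra_simps)
qed

lemma G_rival: "G \<mu> n (rival I n) = - \<mu> * rival I n powr dissim I n"
proof -
  have "rival I n * rival I n powr (dissim I n - 1) = rival I n powr dissim I n"
    using rival_ge[of n] by (cases "rival I n = 0") (auto simp: powr_mult_base)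
  then show ?thesis by (simp add: G_def)
qed

lemma sum_nests: "S \<subseteq> locs I \<Longrightarrow> (\<Sum>n = 1..num_nests I. sum f {i \<in> S. nest_of I i = n}) = sum f S"
  using nest_of finite_subset[OF _ finite_locs] by (intro sum.group) auto

lemma surplus_eq:
  "numer I S - \<mu> * denom I S + \<mu> * base_den I =
    (\<Sum>n = 1..num_nests I. G \<mu> n (weight I S n) - G \<mu> n (rival I n))"
  unfolding G_rival unfolding numer_def denom_def base_den_def G_def
  by (simp add: sum.distrib sum_subtractf sum_distrib_left sum_negf)

lemma sum_gain_le:
  assumes "S \<subseteq> locs I" "\<mu> \<le> 1"
  shows "(\<Sum>i \<in> S. num_gain I i - \<mu> * den_gain I i) - \<mu> * base_den I \<le> numer I S - \<mu> * denom I S"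
proof -
  have "(\<Sum>i \<in> S. num_gain I i - \<mu> * den_gain I i) =
      (\<Sum>n = 1..num_nests I. \<Sum>i \<in> {i \<in> S. nest_of I i = n}. num_gain I i - \<mu> * den_gain I i)"
    by (rule sum_nests[OF assms(1), symmetric])
  also have "\<dots> \<le> (\<Sum>n = 1..num_nests I. G \<mu> n (weight I S n) - G \<mu> n (rival I n))"
  proof (rule sum_mono)
    fix n assume n: "n \<in> {1..num_nests I}"
    interpret concave_gain "V I" "nest_locs I n" "G \<mu> n" "rival I n" using n assms by (intro concave)
    have sub: "{i \<in> S. nest_of I i = n} \<subseteq> nest_locs I n" using assms by (auto simp: nest_locs_def)
    have "(\<Sum>i \<in> {i \<in> S. nest_of I i = n}. num_gain I i - \<mu> * den_gain I i) = sum gain {i \<in> S. nest_of I i = n}"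
      using gain_eq[OF n assms(2)] sub by (intro sum.cong) auto
    then show "(\<Sum>i \<in> {i \<in> S. nest_of I i = n}. num_gain I i - \<mu> * den_gain I i) \<le>
        G \<mu> n (weight I S n) - G \<mu> n (rival I n)"
      using sum_gain_le[OF sub] by (simp add: weight_def)
  qed
  finally show ?thesis using surplus_eq[of S \<mu>] by linarith
qed

lemma sum_gain_ge:
  assumes "S \<subseteq> locs I" "\<mu> \<le> 1"
  shows "\<exists>P \<subseteq> locs I. card P = card S \<and>
    numer I S - \<mu> * denom I S \<le> (\<Sum>i \<in> P. num_gain I i - \<mu> * den_gain I i) - \<mu> * base_den I"
proof -
  let ?\<kappa> = "\<lambda>i. num_gain I i - \<mu> * den_gain I i"
  have "\<exists>P \<subseteq> nest_locs I n. card P = card {i \<in> S. nest_of I i = n} \<and>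
      G \<mu> n (weight I S n) - G \<mu> n (rival I n) \<le> sum ?\<kappa> P" if n: "n \<in> {1..num_nests I}" for n
  proof -
    interpret concave_gain "V I" "nest_locs I n" "G \<mu> n" "rival I n" using n assms by (intro concave)
    have "{i \<in> S. nest_of I i = n} \<subseteq> nest_locs I n" using assms by (auto simp: nest_locs_def)
    from sum_gain_ge[OF mono[OF n assms(2)] this]
    obtain P where P: "P \<subseteq> nest_locs I n" "card P = card {i \<in> S. nest_of I i = n}"
      "G \<mu> n (weight I S n) - G \<mu> n (rival I n) \<le> sum gain P" by (auto simp: weight_def)
    have "sum gain P = sum ?\<kappa> P"
      using gain_eq[OF n assms(2)] P(1) by (intro sum.cong) auto
    then show ?thesis using P by auto
  qed
  then have "\<forall>n \<in> {1..num_nests I}. \<exists>P. P \<subseteq> nest_locs I n \<and> card P = card {i \<in> S. nest_of I i = n} \<and>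
      G \<mu> n (weight I S n) - G \<mu> n (rival I n) \<le> sum ?\<kappa> P" by blast
  from bchoice[OF this] obtain P where P: "\<And>n. n \<in> {1..num_nests I} \<Longrightarrow> P n \<subseteq> nest_locs I n \<and>
      card (P n) = card {i \<in> S. nest_of I i = n} \<and>
      G \<mu> n (weight I S n) - G \<mu> n (rival I n) \<le> sum ?\<kappa> (P n)" by blast
  define Q where "Q = (\<Union>n \<in> {1..num_nests I}. P n)"
  have Q: "Q \<subseteq> locs I" using P unfolding Q_def nest_locs_def by blast
  have part: "{i \<in> Q. nest_of I i = n} = P n" if "n \<in> {1..num_nests I}" for n
  proof -
    have "\<And>k. k \<in> {1..num_nests I} \<Longrightarrow> P k \<subseteq> nest_locs I k" using P by blast
    then show ?thesis using that unfolding Q_def nest_locs_def by blast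
  qed
  have "card Q = (\<Sum>n = 1..num_nests I. card {i \<in> Q. nest_of I i = n})"
    unfolding card_eq_sum by (rule sum_nests[OF Q, symmetric])
  also have "\<dots> = (\<Sum>n = 1..num_nests I. card {i \<in> S. nest_of I i = n})"
    using part P by (intro sum.cong) auto
  also have "\<dots> = card S"
    unfolding card_eq_sum by (rule sum_nests[OF assms(1)])
  finally have card: "card Q = card S" .
  have "numer I S - \<mu> * denom I S + \<mu> * base_den I \<le> (\<Sum>n = 1..num_nests I. sum ?\<kappa> (P n))"
    unfolding surplus_eq using P by (intro sum_mono) auto
  also have "\<dots> = (\<Sum>n = 1..num_nests I. sum ?\<kappa> {i \<in> Q. nest_of I i = n})"
    using part by (intro sum.cong) auto
  also have "\<dots> = sum ?\<kappa> Q" by (rule sum_nests[OF Q])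
  finally show ?thesis using Q card by (intro exI[of _ Q]) auto
qed

lemma gain_nonneg:
  assumes "i \<in> locs I" "\<mu> \<le> 1"
  shows "0 \<le> num_gain I i - \<mu> * den_gain I i"
proof -
  let ?n = "nest_of I i"
  have n: "?n \<in> {1..num_nests I}" using nest_of assms by auto
  have "G \<mu> ?n (prior_weight I i) \<le> G \<mu> ?n (prior_weight I i + V I i)"
    using V_pos[of i] prior_weight_ge[of i] by (intro mono_onD[OF mono[OF n assms(2)]]) auto
  then show ?thesis
    by (simp add: G_def num_gain_def den_gain_def Let_def algebra_simps)
qed

lemma den_gain_pos:
  assumes "i \<in> locs I"
  shows "0 < den_gain I i"
proof -
  have "nest_of I i \<in> {1..num_nests I}" using nest_of assms by auto
  then show ?thesis
    using dissim V_pos[of i] prior_weight_ge[of i] rival_ge[of "nest_of I i"]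
    unfolding den_gain_def Let_def by (simp add: powr_less_mono2)
qed

lemma weight_ge: "0 \<le> weight I S n"
  using rival_ge[of n] V_pos by (auto simp: weight_def sum_nonneg less_imp_le add_nonneg_nonneg)

lemma denom_pos:
  assumes "S \<subseteq> locs I" "S \<noteq> {}"
  shows "0 < denom I S"
proof -
  obtain i where i: "i \<in> S" using assms by blast
  let ?n = "nest_of I i"
  have n: "?n \<in> {1..num_nests I}" using nest_of[of i] i assms by auto
  have "finite S" using assms(1) finite_locs by (rule finite_subset)
  then have "V I i \<le> (\<Sum>i \<in> {j \<in> S. nest_of I j = ?n}. V I i)"
    using i V_pos by (intro member_le_sum) (auto intro: less_imp_le)
  then have "weight I S ?n > 0"
    using V_pos[of i] rival_ge[of ?n] by (simp add: weight_def)
  then show ?thesis unfolding denom_def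
    using n by (intro sum_pos2[of _ ?n]) auto
qed

lemma F_eq:
  assumes "x \<in> feasible I"
  shows "F I x = demand I * (numer I {i \<in> locs I. x i = 1} / denom I {i \<in> locs I. x i = 1})"
proof -
  let ?S = "{i \<in> locs I. x i = 1}"
  have open_sum: "(\<Sum>i \<in> nest I n \<inter> locs I. V I i * real (x i)) = (\<Sum>i \<in> {i \<in> ?S. nest_of I i = n}. V I i)"
    if n: "n \<in> {1..num_nests I}" for n
  proof -
    have "x i = 0 \<or> x i = 1" if "i \<in> locs I" for i using assms that by (auto simp: feasible_def)
    moreover have "i \<in> nest I n \<longleftrightarrow> nest_of I i = n" if "i \<in> locs I" for i using nest_of(2)[of i n] n that by auto
    ultimately show ?thesis
      using finite_locs by (intro sum.mono_neutral_cong_right) fastforce+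
  qed
  have rival: "(\<Sum>i \<in> nest I n \<inter> competitors I. V I i) = rival I n" if n: "n \<in> {1..num_nests I}" for n
    unfolding rival_def using nest_of(2)[of _ n] n by (intro sum.cong) auto
  have W: "W I x n = weight I ?S n" if n: "n \<in> {1..num_nests I}" for n
    using open_sum[OF n] rival[OF n] by (simp add: W_def weight_def)
  have "W I x n powr (dissim I n - 1) * (\<Sum>i \<in> nest I n \<inter> locs I. V I i * real (x i)) =
      weight I ?S n powr dissim I n - rival I n * weight I ?S n powr (dissim I n - 1)"
    if n: "n \<in> {1..num_nests I}" for n
  proof -
    have "weight I ?S n * weight I ?S n powr (dissim I n - 1) = weight I ?S n powr dissim I n"
      using weight_ge[of ?S n] by (cases "weight I ?S n = 0") (auto simp: powr_mult_base)
    moreover have "(\<Sum>i \<in> nest I n \<inter> locs I. V I i * real (x i)) = weight I ?S n - rival I n"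
      using open_sum[OF n] by (simp add: weight_def)
    ultimately show ?thesis unfolding W[OF n] by (simp add: left_diff_distrib mult.commute)
  qed
  then show ?thesis using W by (simp add: F_def numer_def denom_def)
qed

lemma optimal:
  assumes S: "top_set (num_locs I) (capacity I)
      (\<lambda>i. num_gain I i - best_ratio (num_locs I) (capacity I) (num_gain I) (den_gain I) (base_den I) * den_gain I i) S"
    and x: "\<And>i. i \<in> locs I \<Longrightarrow> x i = (if i \<in> S then 1 else 0)"
  shows "restrict x (locs I) \<in> feasible I" "F I (restrict x (locs I)) = Max (F I ` feasible I)"
proof -
  define \<rho> where "\<rho> = best_ratio (num_locs I) (capacity I) (num_gain I) (den_gain I) (base_den I)"
  let ?m = "num_locs I" and ?r = "capacity I" and ?x = "restrict x (locs I)"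
  let ?\<kappa> = "\<lambda>i. num_gain I i - \<rho> * den_gain I i"
  have S': "S \<subseteq> locs I" "card S = min ?m ?r" using S by (auto simp: top_set_def locs_def)
  have "finite S" using S'(1) finite_locs by (rule finite_subset)
  have "(\<Sum>i \<in> locs I. ?x i) = (\<Sum>i \<in> S. 1)"
    using x S' finite_locs by (intro sum.mono_neutral_cong_right) auto
  then show feas: "?x \<in> feasible I" using x S' by (auto simp: feasible_def)
  have xS: "{i \<in> locs I. ?x i = 1} = S" using x S' by auto
  have "F I y \<le> F I ?x" if y: "y \<in> feasible I" for y
  proof -
    define T where "T = {i \<in> locs I. y i = 1}"
    have T: "T \<subseteq> locs I" by (auto simp: T_def)
    have "(\<Sum>i \<in> locs I. y i) = (\<Sum>i \<in> T. 1)"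
    proof (rule sum.mono_neutral_cong_right)
      show "\<forall>i \<in> locs I - T. y i = 0"
      proof
        fix i assume "i \<in> locs I - T"
        moreover from this have "y i \<in> {0, 1}" using y unfolding feasible_def by blast
        ultimately show "y i = 0" by (auto simp: T_def)
      qed
    qed (use finite_locs in \<open>auto simp: T_def\<close>)
    then have cardT: "card T \<le> min ?m ?r"
      using y card_mono[OF finite_locs T] by (auto simp: feasible_def locs_def)
    have FT: "F I y = demand I * (numer I T / denom I T)" using F_eq[OF y] by (simp add: T_def)
    have FS: "F I ?x = demand I * (numer I S / denom I S)" using F_eq[OF feas] by (simp only: xS)
    show ?thesis
    proof (cases "min ?m ?r = 0")
      case True
      then have "T = {}" "S = {}" using cardT S' finite_subset[OF T finite_locs] \<open>finite S\<close> by auto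
      then show ?thesis by (simp add: FT FS)
    next
      case False
      then have pos: "1 \<le> ?m" "1 \<le> ?r" "S \<noteq> {}" using S' by auto
      let ?R = "{S. S \<subseteq> {1..?m} \<and> card S = min ?m ?r}"
      let ?q = "\<lambda>S. sum (num_gain I) S / (base_den I + sum (den_gain I) S)"
      have "finite ?R" by (rule finite_subset[of _ "Pow {1..?m}"]) auto
      then have "\<rho> \<in> ?q ` ?R"
        unfolding \<rho>_def best_ratio_def using S' by (intro Max_in) (auto simp: locs_def)
      then obtain U where U: "U \<subseteq> locs I" "\<rho> = ?q U" by (auto simp: locs_def)
      have num: "0 \<le> sum (num_gain I) U"
        using gain_nonneg[of _ 0] U by (intro sum_nonneg) auto
      have den: "0 \<le> base_den I + sum (den_gain I) U"
        using den_gain_pos U base_den_ge by (intro add_nonneg_nonneg sum_nonneg) (auto intro: less_imp_le)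
      have "numer I U \<le> denom I U"
        unfolding numer_def denom_def using rival_ge by (intro sum_mono) simp
      then have "sum (num_gain I) U \<le> base_den I + sum (den_gain I) U"
        using sum_gain_le[OF U(1), of 1] by (simp add: sum_subtractf)
      then have \<rho>: "0 \<le> \<rho>" "\<rho> \<le> 1"
        using num den U(2) by (auto simp: divide_le_eq_1)
      have zero: "sum ?\<kappa> S - \<rho> * base_den I = 0"
        using best_ratio_cases[of ?m ?r "base_den I" "den_gain I" "num_gain I" \<rho> S]
          pos base_den_ge den_gain_pos S by (force simp: \<rho>_def locs_def)
      then have "\<rho> * denom I S \<le> numer I S"
        using sum_gain_le[OF S'(1) \<rho>(2)] by simp
      then have lower: "\<rho> \<le> numer I S / denom I S"
        using denom_pos[OF S'(1) pos(3)] by (simp add: pos_le_divide_eq)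
      obtain P where P: "P \<subseteq> locs I" "card P = card T"
        "numer I T - \<rho> * denom I T \<le> sum ?\<kappa> P - \<rho> * base_den I"
        using sum_gain_ge[OF T \<rho>(2)] by blast
      obtain Q where Q: "P \<subseteq> Q" "Q \<subseteq> locs I" "card Q = min ?m ?r"
        using exists_subset_between[of P "min ?m ?r" "locs I"] P cardT finite_locs by (auto simp: locs_def)
      have "sum ?\<kappa> P \<le> sum ?\<kappa> Q"
        using Q gain_nonneg[OF _ \<rho>(2)] finite_subset[OF Q(2) finite_locs] by (intro sum_mono2) auto
      also have "\<dots> \<le> sum ?\<kappa> S"
        using top_set_sum[OF S] Q by (simp add: \<rho>_def locs_def)
      finally have "numer I T \<le> \<rho> * denom I T" using P(3) zero by simp
      moreover have "0 \<le> denom I T" unfolding denom_def by (intro sum_nonneg) simp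
      ultimately have "numer I T / denom I T \<le> \<rho>"
        using \<rho> by (cases "denom I T = 0") (auto simp: divide_le_eq)
      with lower have "numer I T / denom I T \<le> numer I S / denom I S" by simp
      then show ?thesis unfolding FT FS using demand_ge by (rule mult_left_mono)
    qed
  qed
  then show "F I ?x = Max (F I ` feasible I)"
    using feas finite_feasible by (intro Max_eqI[symmetric]) auto
qed

end

section \<open>The program\<close>

definition utility_exp :: "nexp \<Rightarrow> rexp" where
  "utility_exp i = RExp (RDivide (RGet ''v'' i) (RGet ''sigma'' (NGet ''nest'' i)))"

text \<open>The factor \<open>w / w\<close> is 0 at \<open>w = 0\<close>, as required by \<open>0 powr e = 0\<close>, and 1 elsewhere.\<close>

definition pow_exp :: "rexp \<Rightarrow> rexp \<Rightarrow> rexp" where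
  "pow_exp w e = RTimes (RExp (RTimes e (RLn w))) (RDivide w w)"

lemma rval_pow_exp [simp]: "rval (pow_exp w e) s = rval w s powr rval e s"
  by (simp add: pow_exp_def powr_def)

definition read_rivals_body :: com where
  "read_rivals_body =
     (let \<sigma> = RGet ''sigma'' (nvar ''n''); w = RGet ''c'' (nvar ''n'') in
      Seq (nlet ''i'' (NGet ''C'' (NMinus (nvar ''j'') (NConst 1))))
     (Seq (nlet ''n'' (NGet ''nest'' (nvar ''i'')))
     (Seq (rlet ''B'' (RMinus (rvar ''B'') (pow_exp w \<sigma>)))
     (Seq (RPut ''c'' (nvar ''n'') (RPlus w (utility_exp (nvar ''i''))))
          (rlet ''B'' (RPlus (rvar ''B'') (pow_exp w \<sigma>)))))))"

definition read_rivals :: com where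
  "read_rivals = For ''j'' ''k'' read_rivals_body"

definition scan_prior :: com where
  "scan_prior =
     (let V\<^sub>i = utility_exp (nvar ''i''); V\<^sub>j = utility_exp (nvar ''j''); n' = NGet ''nest'' (nvar ''j'') in
      Cond (BAnd (BAnd (BNot (NLess n' (nvar ''n''))) (BNot (NLess (nvar ''n'') n')))
        (BAnd (BNot (RLess V\<^sub>j V\<^sub>i)) (BNot (BAnd (BNot (RLess V\<^sub>i V\<^sub>j)) (BNot (NLess (nvar ''j'') (nvar ''i'')))))))
        (rlet ''w'' (RPlus (rvar ''w'') V\<^sub>j)) Skip)"

definition write_gain :: com where
  "write_gain =
     (let \<sigma> = RGet ''sigma'' (nvar ''n''); \<tau> = RMinus \<sigma> (RConst 1); w = rvar ''w''; z = rvar ''z'' in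
      Seq (rlet ''z'' (RPlus w (utility_exp (nvar ''i''))))
     (Seq (RPut ''b'' (nvar ''i'') (RMinus (pow_exp z \<sigma>) (pow_exp w \<sigma>)))
          (RPut ''a'' (nvar ''i'') (RMinus (RGet ''b'' (nvar ''i''))
             (RTimes (RGet ''c'' (nvar ''n'')) (RMinus (pow_exp z \<tau>) (pow_exp w \<tau>)))))))"

definition gain_init :: com where
  "gain_init = Seq (nlet ''n'' (NGet ''nest'' (nvar ''i''))) (rlet ''w'' (RGet ''c'' (nvar ''n'')))"

definition compute_gain :: com where
  "compute_gain = Seq gain_init (Seq (For ''j'' ''m'' scan_prior) write_gain)"

definition compute_gains :: com where
  "compute_gains = For ''i'' ''m'' compute_gain"

definition solver :: com where
  "solver = Seq read_rivals (Seq compute_gains optimize)"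

lemma writes_body [simp]:
  "nwrites read_rivals_body = {''i'', ''n''}" "rwrites read_rivals_body = {''B'', ''c''}"
  "nwrites scan_prior = {}" "rwrites scan_prior = {''w''}"
  "nwrites write_gain = {}" "rwrites write_gain = {''z'', ''b'', ''a''}"
  "nwrites gain_init = {''n''}" "rwrites gain_init = {''w''}"
  "nwrites compute_gain = {''n'', ''j''}" "rwrites compute_gain = {''w'', ''z'', ''b'', ''a''}"
  by (auto simp: read_rivals_body_def scan_prior_def write_gain_def gain_init_def compute_gain_def Let_def)

lemma writes_phases [simp]:
  "nwrites read_rivals = {''i'', ''n'', ''j''}" "rwrites read_rivals = {''B'', ''c''}"
  "nwrites compute_gains = {''i'', ''n'', ''j''}" "rwrites compute_gains = {''w'', ''z'', ''b'', ''a''}"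
  by (auto simp: read_rivals_def compute_gains_def)

definition carries :: "mcp_nl \<Rightarrow> state \<Rightarrow> bool" where
  "carries I s \<longleftrightarrow> fst s ''m'' 0 = num_locs I \<and> fst s ''r'' 0 = capacity I \<and>
     fst s ''k'' 0 = card (competitors I) \<and>
     (\<forall>j < card (competitors I). fst s ''C'' j = sorted_list_of_set (competitors I) ! j) \<and>
     (\<forall>i \<in> locs I \<union> competitors I. fst s ''nest'' i = nest_of I i \<and> snd s ''v'' i = utility I i) \<and>
     (\<forall>n \<in> {1..num_nests I}. snd s ''sigma'' n = dissim I n)"

lemma carries_input: "carries I (input I \<epsilon>)"
  by (auto simp: carries_def input_def scalar_def)

lemma carries_framed:
  assumes "carries I s" "framed c s s'" "nwrites c \<inter> {''m'', ''r'', ''k'', ''C'', ''nest''} = {}"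
    "rwrites c \<inter> {''v'', ''sigma''} = {}"
  shows "carries I s'"
proof -
  have "\<forall>a \<in> {''m'', ''r'', ''k'', ''C'', ''nest''}. fst s' a = fst s a"
    "\<forall>a \<in> {''v'', ''sigma''}. snd s' a = snd s a"
    using assms(2-4) by (simp_all add: framed_def)
  then show ?thesis using assms(1) by (simp add: carries_def)
qed

context nl_instance
begin

lemma rval_utility:
  assumes "carries I s" "nval e s = i" "i \<in> locs I \<union> competitors I"
  shows "rval (utility_exp e) s = V I i"
  using assms nest_of(1)[OF assms(3)] by (auto simp: utility_exp_def carries_def V_def)

lemma halts_read_rivals:
  assumes car: "carries I s" and init: "snd s ''B'' 0 = 0" "snd s ''c'' = (\<lambda>_. 0)"
  shows "halts read_rivals (8 + card (competitors I) * 161) s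
    (\<lambda>s'. (\<forall>n \<in> {1..num_nests I}. snd s' ''c'' n = rival I n) \<and> snd s' ''B'' 0 = base_den I)"
proof -
  define C where "C = sorted_list_of_set (competitors I)"
  let ?k = "card (competitors I)" and ?N = "{1..num_nests I}"
  define Inv where "Inv i s' \<longleftrightarrow>
      (\<forall>n \<in> ?N. snd s' ''c'' n = (\<Sum>l < i. if nest_of I (C ! l) = n then V I (C ! l) else 0)) \<and>
      snd s' ''B'' 0 = (\<Sum>n \<in> ?N. snd s' ''c'' n powr dissim I n)" for i :: nat and s' :: state
  have C: "bij_betw ((!) C) {..<?k} (competitors I)"
    unfolding C_def using finite_competitors by (intro bij_betw_nth) auto
  have "halts read_rivals (8 + ?k * (150 + 11)) s (Inv ?k)"
    unfolding read_rivals_def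
  proof (rule halts_For)
    show "fst s ''k'' 0 = ?k" using car by (simp add: carries_def)
    show "Inv 0 (nput ''j'' 0 0 s)" using init by (simp add: Inv_def)
    fix i s' assume i: "i < ?k" and inv: "Inv i s'" and fr: "framed (For ''j'' ''k'' read_rivals_body) s s'"
    have car': "carries I s'" by (rule carries_framed[OF car fr]) auto
    define p where "p = C ! i"
    define n where "n = nest_of I p"
    have p: "p \<in> competitors I" using C i by (auto simp: p_def bij_betw_def)
    then have n: "n \<in> ?N" using nest_of by (auto simp: n_def)
    have vals: "fst s' ''C'' i = p" "fst s' ''nest'' p = n" "snd s' ''sigma'' n = dissim I n"
      "snd s' ''v'' p = utility I p"
      using car' i p n by (auto simp: carries_def p_def C_def n_def)
    let ?c = "(snd s' ''c'')(n := snd s' ''c'' n + V I p)"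
    have c: "snd (exec read_rivals_body (nput ''j'' 0 (Suc i) s')) ''c'' = ?c"
      by (simp add: read_rivals_body_def Let_def vals utility_exp_def V_def n_def[symmetric])
    have B: "snd (exec read_rivals_body (nput ''j'' 0 (Suc i) s')) ''B'' 0 =
        snd s' ''B'' 0 - snd s' ''c'' n powr dissim I n + ?c n powr dissim I n"
      by (simp add: read_rivals_body_def Let_def vals utility_exp_def V_def n_def[symmetric])
    show "halts read_rivals_body 150 (nput ''j'' 0 (Suc i) s') (Inv (Suc i))"
    proof (rule halts_exec)
      show "Inv (Suc i) (exec read_rivals_body (nput ''j'' 0 (Suc i) s'))"
        unfolding Inv_def
      proof (intro conjI ballI)
        show "snd (exec read_rivals_body (nput ''j'' 0 (Suc i) s')) ''c'' k =
          (\<Sum>l < Suc i. if nest_of I (C ! l) = k then V I (C ! l) else 0)" if "k \<in> ?N" for k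
          using inv that n by (auto simp: c Inv_def p_def n_def)
        show "snd (exec read_rivals_body (nput ''j'' 0 (Suc i) s')) ''B'' 0 =
          (\<Sum>n \<in> ?N. snd (exec read_rivals_body (nput ''j'' 0 (Suc i) s')) ''c'' n powr dissim I n)"
          using inv sum.remove[OF _ n, of "\<lambda>n. snd s' ''c'' n powr dissim I n"]
            sum.remove[OF _ n, of "\<lambda>n. ?c n powr dissim I n"]
          unfolding B c by (simp add: Inv_def)
      qed
    qed (auto simp: read_rivals_body_def Let_def pow_exp_def utility_exp_def)
  qed auto
  then show ?thesis
  proof (rule halts_mono)
    fix s' assume inv: "Inv ?k s'"
    have "rival I n = (\<Sum>l < ?k. if nest_of I (C ! l) = n then V I (C ! l) else 0)" for n
      unfolding rival_def sum.inter_filter[OF finite_competitors]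
      using sum.reindex_bij_betw[OF C, of "\<lambda>i. if nest_of I i = n then V I i else 0"] by simp
    then show "(\<forall>n \<in> ?N. snd s' ''c'' n = rival I n) \<and> snd s' ''B'' 0 = base_den I"
      using inv by (simp add: Inv_def base_den_def)
  qed simp
qed

lemma halts_scan_prior:
  assumes car: "carries I s" and i: "i \<in> locs I" "fst s ''i'' 0 = i" "fst s ''n'' 0 = nest_of I i"
    and w: "snd s ''w'' 0 = rival I (nest_of I i)"
  shows "halts (For ''j'' ''m'' scan_prior) (8 + num_locs I * 161) s (\<lambda>s'. snd s' ''w'' 0 = prior_weight I i)"
proof -
  let ?D = "\<lambda>k. {l \<in> {1..k}. nest_of I l = nest_of I i \<and> prior (V I) l i}"
  define Inv where "Inv k s' \<longleftrightarrow> snd s' ''w'' 0 = rival I (nest_of I i) + sum (V I) (?D k)"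
    for k and s' :: state
  have "halts (For ''j'' ''m'' scan_prior) (8 + num_locs I * (150 + 11)) s (Inv (num_locs I))"
  proof (rule halts_For)
    show "fst s ''m'' 0 = num_locs I" using car by (simp add: carries_def)
    show "Inv 0 (nput ''j'' 0 0 s)" using w by (simp add: Inv_def)
    fix k s' assume k: "k < num_locs I" and inv: "Inv k s'" and fr: "framed (For ''j'' ''m'' scan_prior) s s'"
    let ?s = "nput ''j'' 0 (Suc k) s'"
    have eq: "fst ?s ''i'' 0 = i" "fst ?s ''n'' 0 = nest_of I i" using fr i by (auto simp: framed_def)
    have "carries I s'" by (rule carries_framed[OF car fr]) auto
    then have car': "carries I ?s" by (simp add: carries_def)
    have Suc_k: "Suc k \<in> locs I" using k by (simp add: locs_def)
    have vals: "rval (utility_exp (nvar ''i'')) ?s = V I i" "rval (utility_exp (nvar ''j'')) ?s = V I (Suc k)"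
      using car' eq i Suc_k by (auto intro!: rval_utility)
    have nest: "fst s' ''nest'' (Suc k) = nest_of I (Suc k)"
      using car' Suc_k by (auto simp: carries_def)
    have "?D (Suc k) = (if nest_of I (Suc k) = nest_of I i \<and> prior (V I) (Suc k) i then insert (Suc k) (?D k) else ?D k)"
      by (auto simp: le_Suc_eq)
    then have D: "sum (V I) (?D (Suc k)) =
        sum (V I) (?D k) + (if nest_of I (Suc k) = nest_of I i \<and> prior (V I) (Suc k) i then V I (Suc k) else 0)"
      by simp
    show "halts scan_prior 150 ?s (Inv (Suc k))"
    proof (rule halts_exec)
      have "snd (exec scan_prior ?s) ''w'' 0 = snd s' ''w'' 0 +
        (if nest_of I (Suc k) = nest_of I i \<and> prior (V I) (Suc k) i then V I (Suc k) else 0)"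
        using eq by (auto simp: scan_prior_def Let_def vals nest prior_def)
      then show "Inv (Suc k) (exec scan_prior ?s)" using inv unfolding Inv_def D by simp
    qed (auto simp: scan_prior_def Let_def utility_exp_def)
  qed auto
  then show ?thesis
  proof (rule halts_mono)
    have "?D (num_locs I) = {j \<in> nest_locs I (nest_of I i). prior (V I) j i}"
      by (auto simp: nest_locs_def locs_def)
    then show "snd s' ''w'' 0 = prior_weight I i" if "Inv (num_locs I) s'" for s'
      using that by (simp add: Inv_def prior_weight_def)
  qed simp
qed

lemma halts_compute_gains:
  assumes car: "carries I s" and c: "\<forall>n \<in> {1..num_nests I}. snd s ''c'' n = rival I n"
  shows "halts compute_gains (8 + num_locs I * (319 + num_locs I * 161)) s
    (\<lambda>s'. \<forall>i \<in> locs I. snd s' ''a'' i = num_gain I i \<and> snd s' ''b'' i = den_gain I i)"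
proof -
  let ?m = "num_locs I"
  define Inv where "Inv k s' \<longleftrightarrow> (\<forall>i \<in> {1..k}. snd s' ''a'' i = num_gain I i \<and> snd s' ''b'' i = den_gain I i)"
    for k and s' :: state
  have "halts compute_gains (8 + ?m * ((50 + ((8 + ?m * 161) + 250)) + 11)) s (Inv ?m)"
    unfolding compute_gains_def
  proof (rule halts_For)
    show "fst s ''m'' 0 = ?m" using car by (simp add: carries_def)
    show "Inv 0 (nput ''i'' 0 0 s)" by (simp add: Inv_def)
    fix k s' assume k: "k < ?m" and inv: "Inv k s'" and fr: "framed (For ''i'' ''m'' compute_gain) s s'"
    define i where "i = Suc k"
    define n where "n = nest_of I i"
    let ?s = "nput ''i'' 0 i s'"
    have i: "i \<in> locs I" using k by (simp add: locs_def i_def)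
    then have n: "n \<in> {1..num_nests I}" using nest_of by (auto simp: n_def)
    have "carries I s'" by (rule carries_framed[OF car fr]) auto
    then have car': "carries I ?s" by (simp add: carries_def)
    have c': "snd s' ''c'' n = rival I n" using c fr n by (auto simp: framed_def)
    have "halts compute_gain (50 + ((8 + ?m * 161) + 250)) ?s (Inv (Suc k))"
      unfolding compute_gain_def
    proof (rule halts_Seq)
      show "halts gain_init 50 ?s (\<lambda>s'. fst s' ''n'' 0 = n \<and> snd s' ''w'' 0 = rival I n)"
        using car' i c' by (intro halts_exec) (auto simp: gain_init_def carries_def n_def)
      fix s1 assume s1: "fst s1 ''n'' 0 = n \<and> snd s1 ''w'' 0 = rival I n" and fr1: "framed gain_init ?s s1"
      have car1: "carries I s1" by (rule carries_framed[OF car' fr1]) auto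
      have i1: "fst s1 ''i'' 0 = i" using fr1 by (auto simp: framed_def)
      show "halts (Seq (For ''j'' ''m'' scan_prior) write_gain) ((8 + ?m * 161) + 250) s1 (Inv (Suc k))"
      proof (rule halts_Seq)
        show "halts (For ''j'' ''m'' scan_prior) (8 + ?m * 161) s1 (\<lambda>s'. snd s' ''w'' 0 = prior_weight I i)"
          using s1 i i1 by (intro halts_scan_prior car1) (auto simp: n_def)
        fix s2 assume w: "snd s2 ''w'' 0 = prior_weight I i" and fr2: "framed (For ''j'' ''m'' scan_prior) s1 s2"
        have car2: "carries I s2" by (rule carries_framed[OF car1 fr2]) auto
        have eq: "fst s2 ''i'' 0 = i" "fst s2 ''n'' 0 = n" "snd s2 ''c'' n = rival I n"
          "snd s2 ''a'' = snd s' ''a''" "snd s2 ''b'' = snd s' ''b''"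
          using i1 s1 c' fr1 fr2 by (auto simp: framed_def)
        have vals: "snd s2 ''sigma'' n = dissim I n" "rval (utility_exp (nvar ''i'')) s2 = V I i"
          using car2 n eq i by (auto intro!: rval_utility simp: carries_def)
        show "halts write_gain 250 s2 (Inv (Suc k))"
        proof (rule halts_exec)
          have b: "snd (exec write_gain s2) ''b'' = (snd s' ''b'')(i := den_gain I i)"
            by (simp add: write_gain_def Let_def eq vals w den_gain_def n_def[symmetric])
          have a: "snd (exec write_gain s2) ''a'' = (snd s' ''a'')(i := num_gain I i)"
            by (simp add: write_gain_def Let_def eq vals w den_gain_def num_gain_def n_def[symmetric])
          show "Inv (Suc k) (exec write_gain s2)"
            using inv by (auto simp: Inv_def a b i_def le_Suc_eq)
        qed (auto simp: write_gain_def Let_def pow_exp_def utility_exp_def)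
      qed
    qed
    then show "halts compute_gain (50 + ((8 + ?m * 161) + 250)) (nput ''i'' 0 (Suc k) s') (Inv (Suc k))"
      by (simp add: i_def)
  qed auto
  then show ?thesis
    by (rule halts_mono) (auto simp: Inv_def locs_def)
qed

lemma halts_solver:
  fixes \<epsilon> :: real
  defines "m \<equiv> num_locs I" and "r \<equiv> capacity I"
    and "\<rho> \<equiv> best_ratio (num_locs I) (capacity I) (num_gain I) (den_gain I) (base_den I)"
  shows "halts solver (32 + card (competitors I) * 161 + m * (334 + m * 161) +
      r * (26 + m * (107 + m * 46 + r * (26 + m * 52)))) (input I \<epsilon>)
    (\<lambda>s. \<exists>S. top_set m r (\<lambda>i. num_gain I i - \<rho> * den_gain I i) S \<and>
      (\<forall>l \<in> {1..m}. fst s ''x'' l = (if l \<in> S then 1 else 0)))"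
proof -
  let ?k = "card (competitors I)" and ?s = "input I \<epsilon>"
  let ?Q = "\<lambda>s. \<exists>S. top_set m r (\<lambda>i. num_gain I i - \<rho> * den_gain I i) S \<and>
      (\<forall>l \<in> {1..m}. fst s ''x'' l = (if l \<in> S then 1 else 0))"
  let ?T = "16 + m * 15 + r * (26 + m * (107 + m * 46 + r * (26 + m * 52)))"
  have "halts solver ((8 + ?k * 161) + ((8 + m * (319 + m * 161)) + ?T)) ?s ?Q"
    unfolding solver_def
  proof (rule halts_Seq[OF halts_read_rivals[OF carries_input]])
    show "snd ?s ''B'' 0 = 0" "snd ?s ''c'' = (\<lambda>_. 0)" by (auto simp: input_def)
    fix s1
    assume s1: "(\<forall>n \<in> {1..num_nests I}. snd s1 ''c'' n = rival I n) \<and> snd s1 ''B'' 0 = base_den I"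
      and fr1: "framed read_rivals ?s s1"
    have car1: "carries I s1" by (rule carries_framed[OF carries_input fr1]) auto
    have gains: "halts compute_gains (8 + m * (319 + m * 161)) s1
        (\<lambda>s'. \<forall>i \<in> locs I. snd s' ''a'' i = num_gain I i \<and> snd s' ''b'' i = den_gain I i)"
      unfolding m_def using s1 by (intro halts_compute_gains car1) blast
    show "halts (Seq compute_gains optimize) ((8 + m * (319 + m * 161)) + ?T) s1 ?Q"
    proof (rule halts_Seq[OF gains])
      fix s2
      assume ab: "\<forall>i \<in> locs I. snd s2 ''a'' i = num_gain I i \<and> snd s2 ''b'' i = den_gain I i"
        and fr2: "framed compute_gains s1 s2"
      have "carries I s2" by (rule carries_framed[OF car1 fr2]) auto
      then have mr: "fst s2 ''m'' 0 = m" "fst s2 ''r'' 0 = r" by (auto simp: carries_def m_def r_def)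
      have B: "snd s2 ''B'' 0 = base_den I" using s1 fr2 by (auto simp: framed_def)
      have b_pos: "0 < snd s2 ''b'' i" if "i \<in> {1..m}" for i
        using ab den_gain_pos that by (simp add: locs_def m_def)
      have \<rho>: "best_ratio m r (snd s2 ''a'') (snd s2 ''b'') (snd s2 ''B'' 0) = \<rho>"
        unfolding \<rho>_def B m_def[symmetric] r_def[symmetric]
        by (rule best_ratio_cong) (use ab in \<open>auto simp: locs_def m_def\<close>)
      have top: "top_set m r (\<lambda>l. snd s2 ''a'' l - \<rho> * snd s2 ''b'' l) S \<longleftrightarrow>
          top_set m r (\<lambda>i. num_gain I i - \<rho> * den_gain I i) S" for S
        by (rule top_set_cong) (use ab in \<open>auto simp: locs_def m_def\<close>)
      show "halts optimize ?T s2 ?Q"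
        using halts_optimize[of s2 m r] mr B base_den_ge b_pos unfolding \<rho> top by simp
    qed
  qed
  then show ?thesis by (rule halts_mono) (auto simp: algebra_simps)
qed

end

theorem proposition2:
  shows "\<exists>(P :: com) (c :: real). \<forall>(I :: mcp_nl) (\<epsilon> :: real).
    mcp_nl_instance I \<and> \<epsilon> > 0 \<longrightarrow>
      (\<exists>(t :: nat) (s :: state).
         runs P (input I \<epsilon>) t s \<and>
         solution I s \<in> feasible I \<and>
         F I (solution I s) \<ge> Max (F I ` feasible I) - \<epsilon> \<and>
         (num_locs I \<ge> 1 \<and> capacity I \<ge> 1 \<longrightarrow> real t \<le> c * time_bound I \<epsilon>))"
proof (intro exI[of _ solver] exI[of _ "2000 :: real"] allI impI, elim conjE)
  fix I and \<epsilon> :: real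
  assume I: "mcp_nl_instance I" and \<epsilon>: "0 < \<epsilon>"
  interpret nl_instance I by unfold_locales (rule I)
  let ?m = "num_locs I" and ?r = "capacity I" and ?k = "card (competitors I)"
  let ?T = "32 + ?k * 161 + ?m * (334 + ?m * 161) + ?r * (26 + ?m * (107 + ?m * 46 + ?r * (26 + ?m * 52)))"
  obtain t s S where t: "runs solver (input I \<epsilon>) t s" "t \<le> ?T"
    and S: "top_set ?m ?r (\<lambda>i. num_gain I i -
        best_ratio ?m ?r (num_gain I) (den_gain I) (base_den I) * den_gain I i) S"
      "\<forall>l \<in> {1..?m}. fst s ''x'' l = (if l \<in> S then 1 else 0)"
    using halts_solver[of \<epsilon>] unfolding halts_def by blast
  have x: "fst s ''x'' i = (if i \<in> S then 1 else 0)" if "i \<in> locs I" for i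
    using S(2) that by (simp add: locs_def)
  have "real t \<le> 2000 * time_bound I \<epsilon>" if "1 \<le> ?m" "1 \<le> ?r"
  proof -
    define p where "p = ?m\<^sup>2 * ?r\<^sup>2"
    have p: "?m ^ i * ?r ^ j \<le> p" if "i \<le> 2" "j \<le> 2" for i j
      unfolding p_def using that \<open>1 \<le> ?m\<close> \<open>1 \<le> ?r\<close> by (intro mult_mono power_increasing) auto
    have "?T = 32 * (?m ^ 0 * ?r ^ 0) + ?k * 161 + 334 * (?m ^ 1 * ?r ^ 0) + 161 * (?m ^ 2 * ?r ^ 0) +
        26 * (?m ^ 0 * ?r ^ 1) + 107 * (?m ^ 1 * ?r ^ 1) + 46 * (?m ^ 2 * ?r ^ 1) +
        26 * (?m ^ 1 * ?r ^ 2) + 52 * (?m ^ 2 * ?r ^ 2)"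
      by (simp add: algebra_simps power2_eq_square)
    also have "\<dots> \<le> 32 * p + ?k * 161 + 334 * p + 161 * p + 26 * p + 107 * p + 46 * p + 26 * p + 52 * p"
      by (intro add_mono mult_left_mono p order_refl) auto
    finally have "t \<le> 784 * p + 161 * ?k" using t(2) by simp
    then have "real t \<le> 784 * real p + 161 * real ?k"
      by (metis (mono_tags) of_nat_add of_nat_le_iff of_nat_mult of_nat_numeral)
    also have "\<dots> \<le> 1000 * real p + 2000 * real ?k" by simp
    also have "\<dots> \<le> 2000 * (real p * ln (max 2 (1 / \<epsilon>))) + 2000 * real ?k"
    proof -
      have "1 / 2 \<le> ln (2 :: real)" using exp_half_le2 by (subst ln_ge_iff) auto
      also have "\<dots> \<le> ln (max 2 (1 / \<epsilon>))" by (subst ln_le_cancel_iff) auto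
      finally have "real p * (1 / 2) \<le> real p * ln (max 2 (1 / \<epsilon>))" by (rule mult_left_mono) simp
      then show ?thesis by simp
    qed
    finally show ?thesis by (simp add: time_bound_def p_def algebra_simps)
  qed
  then show "\<exists>t s. runs solver (input I \<epsilon>) t s \<and> solution I s \<in> feasible I \<and>
      F I (solution I s) \<ge> Max (F I ` feasible I) - \<epsilon> \<and>
      (?m \<ge> 1 \<and> ?r \<ge> 1 \<longrightarrow> real t \<le> 2000 * time_bound I \<epsilon>)"
    using t(1) optimal[OF S(1) x] \<epsilon> unfolding solution_def by (intro exI[of _ t] exI[of _ s]) auto
qed

end
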